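(* For integers $d\ge2$, the critical point $p_c^{\mathrm b}(\vec{\mathbb{Z}}^d)$ of Bernoulli oriented bond percolation on $\vec{\mathbb{Z}}^d$ is strictly decreasing as a function of $d$, and the critical point $p_c^{\mathrm s}(\vec{\mathbb{Z}}^d)$ of Bernoulli oriented site percolation on $\vec{\mathbb{Z}}^d$ is strictly decreasing as a function of $d$. That is, for every $d\ge2$, $$p_c^{\mathrm b}(\vec{\mathbb{Z}}^{d+1})<p_c^{\mathrm b}(\vec{\mathbb{Z}}^{d})\qquad\text{and}\qquad p_c^{\mathrm s}(\vec{\mathbb{Z}}^{d+1})<p_c^{\mathrm s}(\vec{\mathbb{Z}}^{d}).$$
   Context: $\vec{\mathbb{Z}}^d$ is the oriented graph with vertex set $\mathbb{Z}_+^d$ ($\mathbb{Z}_+=\{0,1,2,\dots\}$) and nearest-neighbour edges oriented away from the origin, i.e. edges from $x$ to $x+e_i$ for $x\in\mathbb{Z}_+^d$ and $1\le i\le d$, where $e_i$ are the canonical unit vectors. In Bernoulli bond (respectively site) percolation with parameter $p\in[0,1]$, each edge (respectively each vertex) is independently open with probability $p$ and closed otherwise; $\mathbb{P}_p$ is the law. The event $\{0\to\infty\}$ is that there is an infinite path $v_0=0,v_1,v_2,\dots$ following the edges in the direction of their orientation, all of whose edges (respectively vertices) are open. The critical points are $p_c^{\mathrm b}(\vec{\mathbb{Z}}^d)=\inf\{p:\mathbb{P}_p(0\to\infty)>0\}$ for bond percolation and $p_c^{\mathrm s}(\vec{\mathbb{Z}}^d)=\inf\{p:\mathbb{P}_p(0\to\infty)>0\}$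 for site percolation. *)

theory Defs
  imports "HOL-Probability.Probability"
begin

text \<open>
  Points with \<open>d\<close> nonnegative integer coordinates are functions \<open>nat \<Rightarrow> nat\<close> vanishing outside
  \<open>{..<d}\<close>, so that the dimension is an ordinary variable; coordinates are numbered from 0.
\<close>

definition lattice :: "nat \<Rightarrow> (nat \<Rightarrow> nat) set" where
  "lattice d = {x. \<forall>i\<ge>d. x i = 0}"

definition origin :: "nat \<Rightarrow> nat" where
  "origin = (\<lambda>_. 0)"

definition unit_vector :: "nat \<Rightarrow> nat \<Rightarrow> nat" where
  "unit_vector i = (\<lambda>j. if j = i then 1 else 0)"

definition oriented_edges :: "nat \<Rightarrow> ((nat \<Rightarrow> nat) \<times> (nat \<Rightarrow> nat)) set" where
  "oriented_edges d = {(x, \<lambda>j. x j + unit_vector i j) | x i. x \<in> lattice d \<and> i < d}"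

definition oriented_path :: "nat \<Rightarrow> (nat \<Rightarrow> (nat \<Rightarrow> nat)) \<Rightarrow> bool" where
  "oriented_path d v \<longleftrightarrow> v 0 = origin \<and> (\<forall>n. (v n, v (Suc n)) \<in> oriented_edges d)"

text \<open>A configuration maps each element of the index set to \<open>True\<close> (open) or \<open>False\<close> (closed).\<close>

definition bernoulli_percolation :: "'a set \<Rightarrow> real \<Rightarrow> ('a \<Rightarrow> bool) measure" where
  "bernoulli_percolation I p = (\<Pi>\<^sub>M i\<in>I. measure_pmf (bernoulli_pmf p))"

text \<open>
  The two events below are measurable: out-degrees are finite, so by Koenig's lemma each is the
  intersection over \<open>n\<close> of the events that there is an open oriented path of length \<open>n\<close>.
\<close>

definition bond_percolation_prob :: "nat \<Rightarrow> real \<Rightarrow> real" where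
  "bond_percolation_prob d p =
     \<P>(\<omega> in bernoulli_percolation (oriented_edges d) p.
        \<exists>v. oriented_path d v \<and> (\<forall>n. \<omega> (v n, v (Suc n))))"

definition site_percolation_prob :: "nat \<Rightarrow> real \<Rightarrow> real" where
  "site_percolation_prob d p =
     \<P>(\<omega> in bernoulli_percolation (lattice d) p.
        \<exists>v. oriented_path d v \<and> (\<forall>n. \<omega> (v n)))"

definition pc_bond :: "nat \<Rightarrow> real" where
  "pc_bond d = Inf {p \<in> {0..1}. bond_percolation_prob d p > 0}"

definition pc_site :: "nat \<Rightarrow> real" where
  "pc_site d = Inf {p \<in> {0..1}. site_percolation_prob d p > 0}"

end

(* Forgetting the last coordinate projects Z_+^(d+1) onto Z_+^d. Explore the open cluster of the
   origin in dimension d, lifting each reached vertex x to a reached vertex (x, k) of dimension d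
   + 1. When the unexamined out-edges (or out-neighbours) of x are examined at height k, those
   found closed get a second chance: with probability at least p^(d+1) the vertical step from (x,
   k) to (x, k + 1) is open and all the failed ones are open at height k + 1. The second chances
   lie above the lifts and have not been examined before. Hence percolation in dimension d + 1 at
   parameter p dominates percolation in dimension d at p + \<epsilon> (1 - p) as soon as d
   \<epsilon> \<le> p^(d+1). This gives the strict inequality once 0 < p_c(d) < 1; the lower bound
   is path counting, and for d = 2 the upper bound is a Peierls argument: the boundary of a finite
   cluster, followed with the cluster on the left, is a closed walk, so half of its steps have a
   closed edge or vertex on the other side. *)

theory Submission
  imports Defs
begin

section \<open>Conditioning on finitely many coordinates\<close>

text \<open>No coupling is built. Paths are cut off at a finite length, and a state of the
  exploration is a pair of partial configurations \<open>\<sigma>\<close> and \<open>\<rho>\<close>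
  in dimensions d and d + 1. The claim is that the conditional path probability given
  \<open>\<sigma>\<close> at the raised parameter is at most the one given \<open>\<rho>\<close> at
  p. It is proved by induction on the number of coordinates that \<open>\<sigma>\<close> leaves
  hidden; a step is an inequality between finite averages. The length tends to infinity only at the
  end. The condition on \<epsilon> comes from treating the raised parameter as all or nothing. Each
  of at most d coordinates gets an independent bonus of probability \<epsilon>; some bonus occurs
  with probability at most d \<epsilon>, and then all the failures are declared open. This is needed
  since all the failures at x share one vertical step: a second chance asks for at most d + 1 open
  coordinates at once. The obstacle is independence. All the unexamined coordinates out of x are
  taken in one block, so that x uses up only one second chance, and the lifts are chosen so that
  whatever later second chances require is still hidden.\<close>

lemma prob_space_bernoulli_percolation: "prob_space (bernoulli_percolation I p)"
  unfolding bernoulli_percolation_def by (intro prob_space_PiM prob_space_measure_pmf)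

lemma measurable_coordinate:
  assumes "c \<in> I"
  shows "Measurable.pred (bernoulli_percolation I p) (\<lambda>\<omega>. \<omega> c)"
proof -
  have "(\<lambda>\<omega>. \<omega> c) \<in> measurable (bernoulli_percolation I p) (measure_pmf (bernoulli_pmf p))"
    unfolding bernoulli_percolation_def using assms by (rule measurable_component_singleton)
  thus ?thesis by (simp add: measurable_cong_sets)
qed

lemma prob_all_equal:
  assumes "Q \<subseteq> I" "finite Q" "0 \<le> p" "p \<le> 1"
  shows "\<P>(\<omega> in bernoulli_percolation I p. \<forall>c\<in>Q. \<omega> c = b) = (if b then p else 1 - p) ^ card Q"
proof -
  interpret product_prob_space "\<lambda>_. measure_pmf (bernoulli_pmf p)" I
    by unfold_locales
  have "emeasure (bernoulli_percolation I p)
      {\<omega> \<in> space (bernoulli_percolation I p). \<forall>c\<in>Q. \<omega> c \<in> {b}} =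
      (\<Prod>c\<in>Q. emeasure (measure_pmf (bernoulli_pmf p)) {b})"
    unfolding bernoulli_percolation_def using assms by (intro emeasure_PiM_Collect) auto
  also have "\<dots> = ennreal ((if b then p else 1 - p) ^ card Q)"
    using assms by (cases b) (simp_all add: emeasure_pmf_single ennreal_power)
  finally show ?thesis
    using assms by (simp add: measure_def)
qed

text \<open>Fubini: the product measure over \<open>I\<close> is the image of a coin for
  \<open>c\<close> times the product over the other coordinates, under insertion of the coin at
  \<open>c\<close>.\<close>

lemma prob_condition_coordinate:
  assumes c: "c \<in> I" and p: "0 \<le> p" "p \<le> 1"
    and Q: "Measurable.pred (bernoulli_percolation I p) Q"
  shows "\<P>(\<omega> in bernoulli_percolation I p. Q \<omega>) =
    p * \<P>(X in bernoulli_percolation (I - {c}) p. Q (X(c := True))) +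
    (1 - p) * \<P>(X in bernoulli_percolation (I - {c}) p. Q (X(c := False)))"
proof -
  let ?B = "measure_pmf (bernoulli_pmf p)"
  let ?M = "bernoulli_percolation (I - {c}) p" and ?N = "bernoulli_percolation I p"
  let ?f = "\<lambda>(x, X). X(c := x)"
  interpret M: prob_space ?M by (rule prob_space_bernoulli_percolation)
  interpret N: prob_space ?N by (rule prob_space_bernoulli_percolation)
  interpret B: prob_space ?B by (rule prob_space_measure_pmf)
  interpret P: pair_prob_space ?B ?M ..
  have ins: "insert c (I - {c}) = I" using c by auto
  have eq: "distr (?B \<Otimes>\<^sub>M ?M) ?N ?f = ?N"
    using distr_pair_PiM_eq_PiM[of "I - {c}" "\<lambda>_. ?B" c]
    by (simp add: bernoulli_percolation_def ins insert_absorb[OF c] prob_space_measure_pmf)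
  have meas: "?f \<in> measurable (?B \<Otimes>\<^sub>M ?M) ?N"
    unfolding bernoulli_percolation_def
    using measurable_add_dim[of c "I - {c}" "\<lambda>_. ?B"] 
    by (subst ins[symmetric], simp only: case_prod_beta) measurable
  let ?A = "{\<omega> \<in> space ?N. Q \<omega>}"
  have A: "?A \<in> sets ?N" using Q by measurable
  have "emeasure ?N ?A = emeasure (?B \<Otimes>\<^sub>M ?M) (?f -` ?A \<inter> space (?B \<Otimes>\<^sub>M ?M))"
    by (subst eq[symmetric], rule emeasure_distr[OF meas A])
  also have "\<dots> = (\<integral>\<^sup>+ b. emeasure ?M (Pair b -` (?f -` ?A \<inter> space (?B \<Otimes>\<^sub>M ?M))) \<partial>?B)"
    by (rule M.emeasure_pair_measure_alt, rule measurable_sets[OF meas A])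
  also have "\<dots> = (\<integral>\<^sup>+ b. emeasure ?M {X \<in> space ?M. Q (X(c := b))} \<partial>?B)"
  proof (rule nn_integral_cong)
    fix b
    have "X(c := b) \<in> space ?N" if "X \<in> space ?M" for X
      using that c unfolding bernoulli_percolation_def by (auto simp: space_PiM PiE_def extensional_def)
    hence "Pair b -` (?f -` ?A \<inter> space (?B \<Otimes>\<^sub>M ?M)) = {X \<in> space ?M. Q (X(c := b))}"
      by (auto simp: space_pair_measure)
    thus "emeasure ?M (Pair b -` (?f -` ?A \<inter> space (?B \<Otimes>\<^sub>M ?M)))
        = emeasure ?M {X \<in> space ?M. Q (X(c := b))}" by simp
  qed
  also have "\<dots> = emeasure ?M {X \<in> space ?M. Q (X(c := True))} * p +
      emeasure ?M {X \<in> space ?M. Q (X(c := False))} * (1 - p)"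
    using p by (subst nn_integral_bernoulli_pmf) auto
  also have "\<dots> = ennreal (p * measure ?M {X \<in> space ?M. Q (X(c := True))} +
      (1 - p) * measure ?M {X \<in> space ?M. Q (X(c := False))})"
    using p by (simp add: M.emeasure_eq_measure mult.commute ennreal_mult ennreal_plus ennreal_minus)
  finally show ?thesis
    using p unfolding N.emeasure_eq_measure by (subst (asm) ennreal_inj) auto
qed

section \<open>Path events under partially revealed configurations\<close>

definition override :: "('c \<rightharpoonup> bool) \<Rightarrow> ('c \<Rightarrow> bool) \<Rightarrow> 'c \<Rightarrow> bool" where
  "override \<sigma> \<omega> c = (case \<sigma> c of None \<Rightarrow> \<omega> c | Some b \<Rightarrow> b)"

definition hits :: "'c set set \<Rightarrow> ('c \<Rightarrow> bool) \<Rightarrow> bool" where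
  "hits \<P> \<omega> \<longleftrightarrow> (\<exists>P\<in>\<P>. \<forall>c\<in>P. \<omega> c)"

text \<open>The conditional probability given that \<open>\<sigma>\<close> has been revealed: by
  independence, conditioning amounts to fixing the revealed coordinates under the same product
  measure, with no division by the probability of \<open>\<sigma>\<close>.\<close>

definition path_prob :: "'c set \<Rightarrow> real \<Rightarrow> 'c set set \<Rightarrow> ('c \<rightharpoonup> bool) \<Rightarrow> real" where
  "path_prob I p \<P> \<sigma> = \<P>(\<omega> in bernoulli_percolation I p. hits \<P> (override \<sigma> \<omega>))"

definition finitary :: "'c set \<Rightarrow> 'c set set \<Rightarrow> bool" where
  "finitary I \<P> \<longleftrightarrow> finite \<P> \<and> (\<forall>P\<in>\<P>. finite P \<and> P \<subseteq> I)"

lemma measurable_hits: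
  assumes "finitary I \<P>"
  shows "Measurable.pred (bernoulli_percolation I p) (\<lambda>\<omega>. hits \<P> (override \<sigma> \<omega>))"
proof -
  have "Measurable.pred (bernoulli_percolation I p) (\<lambda>\<omega>. override \<sigma> \<omega> c)" if "c \<in> I" for c
    unfolding override_def using measurable_coordinate[OF that] by (cases "\<sigma> c") auto
  thus ?thesis
    using assms unfolding hits_def finitary_def
    by (intro pred_intros_finite) auto
qed

lemma hits_mono: "hits \<P> \<omega> \<Longrightarrow> (\<And>c. \<omega> c \<Longrightarrow> \<omega>' c) \<Longrightarrow> hits \<P> \<omega>'"
  unfolding hits_def by blast

lemma path_prob_mono:
  assumes "finitary I \<P>" and "\<And>\<omega> c. override \<sigma> \<omega> c \<Longrightarrow> override \<sigma>' \<omega> c"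
  shows "path_prob I p \<P> \<sigma> \<le> path_prob I p \<P> \<sigma>'"
proof -
  interpret prob_space "bernoulli_percolation I p" by (rule prob_space_bernoulli_percolation)
  show ?thesis unfolding path_prob_def
    using measurable_hits[OF assms(1)] assms(2)
    by (intro finite_measure_mono) (auto intro: hits_mono)
qed

lemma path_prob_nonneg: "0 \<le> path_prob I p \<P> \<sigma>"
  unfolding path_prob_def by simp

lemma path_prob_le_1: "path_prob I p \<P> \<sigma> \<le> 1"
proof -
  interpret prob_space "bernoulli_percolation I p" by (rule prob_space_bernoulli_percolation)
  show ?thesis unfolding path_prob_def by simp
qed

text \<open>All three terms are split at \<open>c\<close>. Where \<open>c\<close> is already
  assigned, the override discards the random bit, so both halves agree.\<close>

lemma path_prob_split:
  assumes "finitary I \<P>" "c \<in> I" "\<sigma> c = None" "0 \<le> p" "p \<le> 1"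
  shows "path_prob I p \<P> \<sigma> =
    p * path_prob I p \<P> (\<sigma>(c \<mapsto> True)) + (1 - p) * path_prob I p \<P> (\<sigma>(c \<mapsto> False))"
proof -
  let ?m = "\<lambda>\<tau> b. \<P>(X in bernoulli_percolation (I - {c}) p. hits \<P> (override \<tau> (X(c := b))))"
  have split: "path_prob I p \<P> \<tau> = p * ?m \<tau> True + (1 - p) * ?m \<tau> False" for \<tau>
    unfolding path_prob_def
    by (rule prob_condition_coordinate[OF assms(2,4,5) measurable_hits[OF assms(1)]])
  have "?m (\<sigma>(c \<mapsto> b)) b' = ?m \<sigma> b" for b b'
  proof -
    have "override (\<sigma>(c \<mapsto> b)) (X(c := b')) = override \<sigma> (X(c := b))" for X
      using assms(3) by (auto simp: override_def fun_eq_iff split: option.split)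
    thus ?thesis by (simp only:)
  qed
  thus ?thesis
    by (simp add: split algebra_simps)
qed

section \<open>Revealing a block of coordinates\<close>

text \<open>For distinct entries, the expectation of \<open>h\<close> at the union of
  \<open>S\<close> with a random subset of \<open>ks\<close> that contains each entry independently
  with probability \<open>p\<close>. The recursion mirrors \<open>path_prob_split\<close>.\<close>

primrec subset_mean :: "real \<Rightarrow> 'i list \<Rightarrow> ('i set \<Rightarrow> real) \<Rightarrow> 'i set \<Rightarrow> real" where
  "subset_mean p [] h S = h S"
| "subset_mean p (i # ks) h S =
     p * subset_mean p ks h (insert i S) + (1 - p) * subset_mean p ks h S"

lemma subset_mean_mono:
  assumes "0 \<le> p" "p \<le> 1" "\<And>B. S \<subseteq> B \<Longrightarrow> B \<subseteq> S \<union> set ks \<Longrightarrow> f B \<le> g B"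
  shows "subset_mean p ks f S \<le> subset_mean p ks g S"
  using assms(3)
proof (induction ks arbitrary: S)
  case (Cons i ks)
  have "subset_mean p ks f (insert i S) \<le> subset_mean p ks g (insert i S)"
    by (rule Cons.IH, rule Cons.prems) auto
  moreover have "subset_mean p ks f S \<le> subset_mean p ks g S"
    by (rule Cons.IH, rule Cons.prems) auto
  ultimately show ?case
    using assms(1,2) by (auto intro!: add_mono mult_left_mono)
qed auto

lemma subset_mean_affine:
  "subset_mean p ks (\<lambda>B. a * h B + b) S = a * subset_mean p ks h S + b"
  by (induction ks arbitrary: S) (auto simp: algebra_simps)

lemma subset_mean_le_top:
  assumes "0 \<le> p" "p \<le> 1" "\<And>A B. A \<subseteq> B \<Longrightarrow> B \<subseteq> S \<union> set ks \<Longrightarrow> h A \<le> h B"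
  shows "subset_mean p ks h S \<le> h (S \<union> set ks)"
proof -
  have "subset_mean p ks h S \<le> subset_mean p ks (\<lambda>B. 0 * h B + h (S \<union> set ks)) S"
    using assms by (intro subset_mean_mono) auto
  thus ?thesis unfolding subset_mean_affine by simp
qed

text \<open>A \<open>p'\<close>-random set is the union of a \<open>p\<close>-random and an \<open>\<epsilon>\<close>-random set; whenever the latter is
  nonempty it is replaced by the full set.\<close>

lemma subset_mean_sprinkle:
  assumes "0 \<le> p" "p \<le> 1" "0 \<le> \<epsilon>" "\<epsilon> \<le> 1"
    and "\<And>A B. A \<subseteq> B \<Longrightarrow> B \<subseteq> S \<union> set ks \<Longrightarrow> h A \<le> h B"
  shows "subset_mean (p + \<epsilon> * (1 - p)) ks h S \<le>
    (1 - \<epsilon>) ^ length ks * subset_mean p ks h S + (1 - (1 - \<epsilon>) ^ length ks) * h (S \<union> set ks)"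
  using assms(5)
proof (induction ks arbitrary: S)
  case (Cons i ks)
  define p' where "p' = p + \<epsilon> * (1 - p)"
  define q where "q = (1 - \<epsilon>) ^ length ks"
  define E1 where "E1 = subset_mean p ks h (insert i S)"
  define E0 where "E0 = subset_mean p ks h S"
  define M where "M = h (S \<union> set (i # ks))"
  have "\<epsilon> * (1 - p) \<le> 1 * (1 - p)"
    using assms by (intro mult_right_mono) auto
  hence p': "0 \<le> p'" "p' \<le> 1" unfolding p'_def using assms by auto
  have q: "0 \<le> q" "q \<le> 1" unfolding q_def using assms by (auto intro: power_le_one)
  have "E1 \<le> h (insert i S \<union> set ks)"
    unfolding E1_def using Cons.prems assms by (intro subset_mean_le_top) auto
  hence E1: "E1 \<le> M" by (simp add: M_def)
  have "subset_mean p' ks h (insert i S) \<le> q * E1 + (1 - q) * h (insert i S \<union> set ks)"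
    unfolding q_def p'_def E1_def by (rule Cons.IH, rule Cons.prems) auto
  hence 1: "subset_mean p' ks h (insert i S) \<le> q * E1 + (1 - q) * M" by (simp add: M_def)
  have "subset_mean p' ks h S \<le> q * E0 + (1 - q) * h (S \<union> set ks)"
    unfolding q_def p'_def E0_def by (rule Cons.IH, rule Cons.prems) auto
  also have "\<dots> \<le> q * E0 + (1 - q) * M"
    unfolding M_def using q by (intro add_left_mono mult_left_mono Cons.prems) auto
  finally have 0: "subset_mean p' ks h S \<le> q * E0 + (1 - q) * M" .
  have "subset_mean p' (i # ks) h S \<le> p' * (q * E1 + (1 - q) * M) + (1 - p') * (q * E0 + (1 - q) * M)"
    using 0 1 p' by (auto intro!: add_mono mult_left_mono)
  also have "\<dots> = q * (1 - \<epsilon>) * (p * E1 + (1 - p) * E0) + q * \<epsilon> * E1 + (1 - q) * M"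
    unfolding p'_def by (simp add: algebra_simps)
  \<comment> \<open>If \<open>i\<close> itself is sprinkled, \<open>E1\<close> is raised to the
    value \<open>M\<close> of the full set.\<close>
  also have "\<dots> \<le> q * (1 - \<epsilon>) * (p * E1 + (1 - p) * E0) + q * \<epsilon> * M + (1 - q) * M"
    using E1 q assms by (intro add_mono mult_left_mono) auto
  also have "\<dots> = q * (1 - \<epsilon>) * (p * E1 + (1 - p) * E0) + (1 - q * (1 - \<epsilon>)) * M"
    by (simp add: algebra_simps)
  finally show ?case
    unfolding p'_def q_def E1_def E0_def M_def by (simp add: mult.commute)
qed auto

text \<open>With probability at least \<open>p ^ length ks\<close> every entry is selected, which is
  worth at least \<open>U\<close>; any other outcome is worth at least \<open>L\<close>.\<close>

lemma subset_mean_lower: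
  assumes "0 \<le> p" "p \<le> 1" "L \<le> U" "U \<le> f (S \<union> set ks)"
    and "\<And>B. S \<subseteq> B \<Longrightarrow> B \<subseteq> S \<union> set ks \<Longrightarrow> L \<le> f B"
  shows "L + p ^ length ks * (U - L) \<le> subset_mean p ks f S"
  using assms(4,5)
proof (induction ks arbitrary: S)
  case (Cons i ks)
  have 1: "L + p ^ length ks * (U - L) \<le> subset_mean p ks f (insert i S)"
    using Cons.prems by (intro Cons.IH) auto
  have "subset_mean p ks (\<lambda>B. 0 * f B + L) S \<le> subset_mean p ks f S"
    using assms Cons.prems by (intro subset_mean_mono) auto
  hence 0: "L \<le> subset_mean p ks f S" unfolding subset_mean_affine by simp
  have "p * (L + p ^ length ks * (U - L)) + (1 - p) * L \<le> subset_mean p (i # ks) f S"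
    using 0 1 assms by (auto intro!: add_mono mult_left_mono)
  thus ?case by (simp add: algebra_simps)
qed auto

text \<open>Block and outcome are sets of indices, not of coordinates: the directions out of a
  vertex can then index a block in dimension d and, through another map \<open>c\<close>, the lifted
  block in dimension d + 1.\<close>

definition reveal :: "('i \<Rightarrow> 'c) \<Rightarrow> 'i set \<Rightarrow> 'i set \<Rightarrow> ('c \<rightharpoonup> bool) \<Rightarrow> 'c \<rightharpoonup> bool" where
  "reveal c D S \<sigma> z = (if z \<in> c ` D then Some (z \<in> c ` S) else \<sigma> z)"

text \<open>Iteration of \<open>path_prob_split\<close>; the part \<open>D\<close> revealed so far,
  with its open part \<open>S\<close>, carries the induction.\<close>

lemma path_prob_subset_mean:
  assumes "finitary I \<P>" "0 \<le> p" "p \<le> 1"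
    and "distinct ks" "set ks \<inter> D = {}" "S \<subseteq> D" "inj_on c (D \<union> set ks)"
    and "c ` set ks \<subseteq> I" "\<And>i. i \<in> set ks \<Longrightarrow> \<sigma> (c i) = None"
  shows "path_prob I p \<P> (reveal c D S \<sigma>) =
    subset_mean p ks (\<lambda>B. path_prob I p \<P> (reveal c (D \<union> set ks) B \<sigma>)) S"
  using assms(4-)
proof (induction ks arbitrary: D S)
  case (Cons i ks)
  have fresh: "c i \<notin> c ` D" "c i \<notin> c ` S"
    using Cons.prems by (auto simp: inj_on_def)
  have "path_prob I p \<P> (reveal c D S \<sigma>) =
      p * path_prob I p \<P> ((reveal c D S \<sigma>)(c i \<mapsto> True)) +
      (1 - p) * path_prob I p \<P> ((reveal c D S \<sigma>)(c i \<mapsto> False))"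
    using Cons.prems fresh assms by (intro path_prob_split) (auto simp: reveal_def)
  also have "(reveal c D S \<sigma>)(c i \<mapsto> True) = reveal c (insert i D) (insert i S) \<sigma>"
    using fresh by (auto simp: reveal_def fun_eq_iff)
  also have "(reveal c D S \<sigma>)(c i \<mapsto> False) = reveal c (insert i D) S \<sigma>"
    using fresh by (auto simp: reveal_def fun_eq_iff)
  also have "path_prob I p \<P> (reveal c (insert i D) (insert i S) \<sigma>) =
      subset_mean p ks (\<lambda>B. path_prob I p \<P> (reveal c (insert i D \<union> set ks) B \<sigma>)) (insert i S)"
    using Cons.prems by (intro Cons.IH) (auto simp: inj_on_def)
  also have "path_prob I p \<P> (reveal c (insert i D) S \<sigma>) =
      subset_mean p ks (\<lambda>B. path_prob I p \<P> (reveal c (insert i D \<union> set ks) B \<sigma>)) S"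
    using Cons.prems by (intro Cons.IH) (auto simp: inj_on_def)
  finally show ?case by simp
qed auto

corollary path_prob_reveal:
  assumes "finitary I \<P>" "0 \<le> p" "p \<le> 1" "distinct ks" "inj_on c (set ks)"
    and "c ` set ks \<subseteq> I" "\<And>i. i \<in> set ks \<Longrightarrow> \<sigma> (c i) = None"
  shows "path_prob I p \<P> \<sigma> = subset_mean p ks (\<lambda>B. path_prob I p \<P> (reveal c (set ks) B \<sigma>)) {}"
proof -
  have "reveal c {} {} \<sigma> = \<sigma>" by (simp add: reveal_def fun_eq_iff)
  thus ?thesis using path_prob_subset_mean[of I \<P> p ks "{}" "{}" c \<sigma>] assms by simp
qed

text \<open>One exploration step, common to sites and bonds. On the side of \<open>I\<close> the
  block \<open>D\<close> is revealed at the raised parameter. On the side of \<open>J\<close> the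
  lifted block is revealed at \<open>p\<close>, and then the second-chance block \<open>T B\<close>.
  By \<open>first\<close> the second chance never hurts, by \<open>second\<close> its success is as
  good as having all of \<open>D\<close> open, and a success is at least as likely as a nonempty
  sprinkled set.\<close>

lemma path_prob_reveal_step:
  fixes c :: "'i \<Rightarrow> 'c" and g :: "'i \<Rightarrow> 'e"
  assumes "finitary I \<P>" "finitary J \<Q>" and p: "0 \<le> p" "p \<le> 1" and \<epsilon>: "0 \<le> \<epsilon>" "\<epsilon> \<le> 1"
    and d\<epsilon>: "real d * \<epsilon> \<le> p ^ (d + 1)"
    and D: "finite D" "card D \<le> d"
    and c: "inj_on c D" "c ` D \<subseteq> I" "\<And>i. i \<in> D \<Longrightarrow> \<sigma> (c i) = None"
    and g: "inj_on g D" "g ` D \<subseteq> J" "\<And>i. i \<in> D \<Longrightarrow> \<rho> (g i) = None"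
    and T: "\<And>B. B \<subseteq> D \<Longrightarrow> finite (T B) \<and> T B \<subseteq> J \<and> card (T B) \<le> d + 1 \<and> T B \<inter> g ` D = {}"
      "\<And>B e. B \<subseteq> D \<Longrightarrow> e \<in> T B \<Longrightarrow> \<rho> e = None"
    and first: "\<And>B U. B \<subseteq> D \<Longrightarrow> U \<subseteq> T B \<Longrightarrow> path_prob I (p + \<epsilon> * (1 - p)) \<P> (reveal c D B \<sigma>)
      \<le> path_prob J p \<Q> (reveal id (T B) U (reveal g D B \<rho>))"
    and second: "\<And>B. B \<subseteq> D \<Longrightarrow> path_prob I (p + \<epsilon> * (1 - p)) \<P> (reveal c D D \<sigma>)
      \<le> path_prob J p \<Q> (reveal id (T B) (T B) (reveal g D B \<rho>))"
  shows "path_prob I (p + \<epsilon> * (1 - p)) \<P> \<sigma> \<le> path_prob J p \<Q> \<rho>"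
proof -
  obtain ks where ks: "set ks = D" "distinct ks"
    using finite_distinct_list[OF D(1)] by blast
  define p' where "p' = p + \<epsilon> * (1 - p)"
  define h where "h B = path_prob I p' \<P> (reveal c D B \<sigma>)" for B
  have "\<epsilon> * (1 - p) \<le> 1 * (1 - p)" using p \<epsilon> by (intro mult_right_mono) auto
  hence p': "0 \<le> p'" "p' \<le> 1" unfolding p'_def using p \<epsilon> by auto
  have h_mono: "h A \<le> h B" if "A \<subseteq> B" for A B
    unfolding h_def using that
    by (intro path_prob_mono assms) (auto simp: override_def reveal_def split: if_splits)
  define q where "q = (1 - \<epsilon>) ^ length ks"
  have "1 + real (length ks) * (- \<epsilon>) \<le> (1 + (- \<epsilon>)) ^ length ks"
    using \<epsilon> by (intro Bernoulli_inequality) auto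
  moreover have "real (length ks) * \<epsilon> \<le> real d * \<epsilon>"
    using D(2) ks \<epsilon> distinct_card[OF ks(2)] by (intro mult_right_mono) auto
  ultimately have q: "1 - q \<le> p ^ (d + 1)"
    unfolding q_def using d\<epsilon> by simp
  \<comment> \<open>\<open>B\<close> is the part of the first block found open. As
    \<open>T B\<close> has at most d + 1 members, all of it is open with probability at least
    \<open>p ^ (d + 1)\<close>.\<close>
  have lower: "(1 - p ^ (d + 1)) * h B + p ^ (d + 1) * h D \<le> path_prob J p \<Q> (reveal g D B \<rho>)"
    if B: "B \<subseteq> D" for B
  proof -
    have "finite (T B)" using T(1)[OF B] by simp
    then obtain ts where ts: "set ts = T B" "distinct ts"
      using finite_distinct_list by blast
    have none: "reveal g D B \<rho> (id e) = None" if "e \<in> set ts" for e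
      using T(1)[OF B] T(2)[OF B] that ts by (auto simp: reveal_def)
    have len: "length ts \<le> d + 1"
      using T(1)[OF B] distinct_card[OF ts(2)] ts by simp
    have "p ^ (d + 1) * (h D - h B) \<le> p ^ length ts * (h D - h B)"
      using p len h_mono[OF B] by (intro mult_right_mono power_decreasing) auto
    moreover have "h B + p ^ length ts * (h D - h B) \<le>
        subset_mean p ts (\<lambda>U. path_prob J p \<Q> (reveal id (set ts) U (reveal g D B \<rho>))) {}"
    proof (rule subset_mean_lower[OF p h_mono[OF B]])
      show "h D \<le> path_prob J p \<Q> (reveal id (set ts) ({} \<union> set ts) (reveal g D B \<rho>))"
        using second[OF B] unfolding h_def p'_def ts(1) by simp
      show "h B \<le> path_prob J p \<Q> (reveal id (set ts) U (reveal g D B \<rho>))"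
        if "U \<subseteq> {} \<union> set ts" for U
        using first[OF B, of U] that unfolding h_def p'_def ts(1) by simp
    qed
    moreover have "\<dots> = path_prob J p \<Q> (reveal g D B \<rho>)"
      by (rule path_prob_reveal[where c = id and ks = ts and \<sigma> = "reveal g D B \<rho>", symmetric])
        (use assms(2) p ts none T(1)[OF B] in auto)
    ultimately show ?thesis by (simp add: algebra_simps)
  qed
  have top: "subset_mean p ks h {} \<le> h D"
    using subset_mean_le_top[of p "{}" ks h] p h_mono ks by simp
  have "path_prob I p' \<P> \<sigma> = subset_mean p' ks h {}"
    unfolding h_def using path_prob_reveal[OF assms(1) p' ks(2), of c \<sigma>] c unfolding ks(1) by blast
  also have "\<dots> \<le> q * subset_mean p ks h {} + (1 - q) * h D"
    using subset_mean_sprinkle[of p \<epsilon> "{}" ks h] p \<epsilon> h_mono ks unfolding p'_def q_def by simp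
  also have "\<dots> = subset_mean p ks h {} + (1 - q) * (h D - subset_mean p ks h {})"
    by (simp add: algebra_simps)
  \<comment> \<open>The weight of \<open>h D\<close> may grow from \<open>1 - q\<close> to
    \<open>p ^ (d + 1)\<close> because \<open>h D\<close> is at least the mean.\<close>
  also have "\<dots> \<le> subset_mean p ks h {} + p ^ (d + 1) * (h D - subset_mean p ks h {})"
    using q top by (intro add_left_mono mult_right_mono) auto
  also have "\<dots> = subset_mean p ks (\<lambda>B. (1 - p ^ (d + 1)) * h B + p ^ (d + 1) * h D) {}"
    unfolding subset_mean_affine by (simp add: algebra_simps)
  also have "\<dots> \<le> subset_mean p ks (\<lambda>B. path_prob J p \<Q> (reveal g D B \<rho>)) {}"
    using lower unfolding ks(1)[symmetric] by (intro subset_mean_mono p) simp_all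
  also have "\<dots> = path_prob J p \<Q> \<rho>"
    using path_prob_reveal[OF assms(2) p ks(2), of g \<rho>] g unfolding ks(1) by (metis (lifting))
  finally show ?thesis unfolding p'_def .
qed

section \<open>Oriented paths\<close>

definition step :: "(nat \<Rightarrow> nat) \<Rightarrow> nat \<Rightarrow> nat \<Rightarrow> nat" where
  "step x i = (\<lambda>j. x j + unit_vector i j)"

primrec walk :: "(nat \<Rightarrow> nat) \<Rightarrow> nat \<Rightarrow> nat \<Rightarrow> nat" where
  "walk ds 0 = origin"
| "walk ds (Suc n) = step (walk ds n) (ds n)"

text \<open>The l1 norm. A walk has level n after exactly n steps, so the level recovers the time
  from the position.\<close>

definition level :: "nat \<Rightarrow> (nat \<Rightarrow> nat) \<Rightarrow> nat" where
  "level d x = (\<Sum>j<d. x j)"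

lemma step_in_lattice: "x \<in> lattice d \<Longrightarrow> i < d \<Longrightarrow> step x i \<in> lattice d"
  by (auto simp: lattice_def step_def unit_vector_def)

lemma origin_in_lattice [simp]: "origin \<in> lattice d"
  by (simp add: lattice_def origin_def)

lemma walk_in_lattice: "(\<And>m. m < n \<Longrightarrow> ds m < d) \<Longrightarrow> walk ds n \<in> lattice d"
  by (induction n) (auto intro: step_in_lattice)

lemma walk_cong: "(\<And>j. j < n \<Longrightarrow> ds j = ds' j) \<Longrightarrow> walk ds n = walk ds' n"
  by (induction n) auto

lemma level_step: "i < d \<Longrightarrow> level d (step x i) = Suc (level d x)"
  by (simp add: level_def step_def unit_vector_def sum.distrib)

lemma level_origin [simp]: "level d origin = 0"
  by (simp add: level_def origin_def)

lemma level_walk: "(\<And>m. m < n \<Longrightarrow> ds m < d) \<Longrightarrow> level d (walk ds n) = n"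
  by (induction n) (auto simp: level_step)

lemma finite_level_le: "finite {x \<in> lattice d. level d x \<le> n}"
proof (rule finite_subset)
  show "{x \<in> lattice d. level d x \<le> n} \<subseteq> {x. \<forall>j. (j \<in> {..<d} \<longrightarrow> x j \<in> {..n}) \<and> (j \<notin> {..<d} \<longrightarrow> x j = 0)}"
  proof (intro subsetI CollectI allI conjI impI)
    fix x j assume x: "x \<in> {x \<in> lattice d. level d x \<le> n}" and "j \<in> {..<d}"
    hence "x j \<le> level d x" unfolding level_def by (intro member_le_sum) auto
    thus "x j \<in> {..n}" using x by auto
  qed (auto simp: lattice_def)
  show "finite {x::nat \<Rightarrow> nat. \<forall>j. (j \<in> {..<d} \<longrightarrow> x j \<in> {..n}) \<and> (j \<notin> {..<d} \<longrightarrow> x j = 0)}"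
    by (rule finite_set_of_finite_funs) auto
qed

lemma oriented_path_iff_walk: "oriented_path d v \<longleftrightarrow> (\<exists>ds. (\<forall>m. ds m < d) \<and> v = walk ds)"
proof
  assume v: "oriented_path d v"
  hence "\<exists>i. i < d \<and> v (Suc n) = step (v n) i" for n
    by (fastforce simp: oriented_path_def oriented_edges_def step_def)
  then obtain ds where ds: "ds n < d \<and> v (Suc n) = step (v n) (ds n)" for n by metis
  have "v n = walk ds n" for n
    using v ds by (induction n) (auto simp: oriented_path_def)
  thus "\<exists>ds. (\<forall>m. ds m < d) \<and> v = walk ds" using ds by blast
next
  assume "\<exists>ds. (\<forall>m. ds m < d) \<and> v = walk ds"
  then obtain ds where "\<forall>m. ds m < d" "v = walk ds" by blast
  thus "oriented_path d v"
    using walk_in_lattice[of _ ds d]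
    by (auto simp: oriented_path_def oriented_edges_def step_def)
qed

definition path_sets :: "nat \<Rightarrow> ((nat \<Rightarrow> nat) \<Rightarrow> nat \<Rightarrow> 'c) \<Rightarrow> nat \<Rightarrow> 'c set set" where
  "path_sets D \<kappa> N = {\<kappa> ds ` {..<N} | ds. \<forall>m. ds m < D}"

lemma hits_path_sets:
  "hits (path_sets D \<kappa> N) \<omega> \<longleftrightarrow> (\<exists>ds. (\<forall>m. ds m < D) \<and> (\<forall>m<N. \<omega> (\<kappa> ds m)))"
  by (auto simp: hits_def path_sets_def)

lemma override_empty [simp]: "override Map.empty \<omega> = \<omega>"
  by (simp add: override_def fun_eq_iff)

text \<open>\<open>\<kappa> ds m\<close> is the edge or vertex examined in the \<open>m\<close>-th step of the path with directions \<open>ds\<close>.\<close>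

locale percolation_model =
  fixes D :: nat and I :: "'c set" and \<kappa> :: "(nat \<Rightarrow> nat) \<Rightarrow> nat \<Rightarrow> 'c"
  assumes D_pos: "0 < D"
    and \<kappa>_cong: "\<And>ds ds' m. (\<And>j. j \<le> m \<Longrightarrow> ds j = ds' j) \<Longrightarrow> \<kappa> ds m = \<kappa> ds' m"
    and \<kappa>_in: "\<And>ds m. (\<And>j. ds j < D) \<Longrightarrow> \<kappa> ds m \<in> I"
    and \<kappa>_inj: "\<And>ds. (\<And>j. ds j < D) \<Longrightarrow> inj (\<kappa> ds)"
begin

text \<open>\<open>\<kappa> ds m\<close> looks only at the first m + 1 directions, so direction
  sequences restricted to \<open>{..<N}\<close> already give all these sets.\<close>

lemma path_sets_bound: "finite (path_sets D \<kappa> N)" "card (path_sets D \<kappa> N) \<le> D ^ N"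
proof -
  let ?F = "PiE {..<N} (\<lambda>_. {..<D})"
  have "path_sets D \<kappa> N \<subseteq> (\<lambda>ds. \<kappa> ds ` {..<N}) ` ?F"
  proof
    fix P assume "P \<in> path_sets D \<kappa> N"
    then obtain ds where ds: "\<forall>m. ds m < D" "P = \<kappa> ds ` {..<N}" by (auto simp: path_sets_def)
    have "\<kappa> ds m = \<kappa> (restrict ds {..<N}) m" if "m < N" for m
      using that by (intro \<kappa>_cong) auto
    hence "P = \<kappa> (restrict ds {..<N}) ` {..<N}" using ds by auto
    moreover have "restrict ds {..<N} \<in> ?F" using ds by auto
    ultimately show "P \<in> (\<lambda>ds. \<kappa> ds ` {..<N}) ` ?F" by blast
  qed
  moreover have "finite ?F" by (intro finite_PiE) auto
  moreover have "card ?F = D ^ N" by (simp add: card_PiE)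
  ultimately show "finite (path_sets D \<kappa> N)" "card (path_sets D \<kappa> N) \<le> D ^ N"
    by (auto intro: finite_surj dest: surj_card_le)
qed

lemma finitary_path_sets: "finitary I (path_sets D \<kappa> N)"
  using path_sets_bound(1)[of N] \<kappa>_in unfolding finitary_def by (auto simp: path_sets_def)

text \<open>\<open>good n ds\<close> says that the first n directions of \<open>ds\<close> begin
  arbitrarily long open paths. Such a prefix can be prolonged by one direction, since there are only
  \<open>D\<close> choices; the prolongations converge to an infinite open path.\<close>

lemma koenig:
  assumes "\<And>N. hits (path_sets D \<kappa> N) \<omega>"
  shows "\<exists>ds. (\<forall>m. ds m < D) \<and> (\<forall>m. \<omega> (\<kappa> ds m))"
proof -
  define good where "good n ds \<longleftrightarrow> (\<forall>N. \<exists>ds'. (\<forall>j<n. ds' j = ds j) \<and> (\<forall>m. ds' m < D) \<and> (\<forall>m<N. \<omega> (\<kappa> ds' m)))"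
    for n and ds :: "nat \<Rightarrow> nat"
  have good_0: "good 0 ds" for ds
    using assms unfolding good_def hits_path_sets by auto
  have good_Suc: "\<exists>ds'. good (Suc n) ds' \<and> (\<forall>j<n. ds' j = ds j)" if "good n ds" for n ds
  proof (rule ccontr)
    assume contr: "\<not> ?thesis"
    define ext where "ext i N ds' \<longleftrightarrow> (\<forall>j<Suc n. ds' j = (ds(n := i)) j) \<and> (\<forall>m. ds' m < D) \<and>
        (\<forall>m<N. \<omega> (\<kappa> ds' m))" for i N and ds' :: "nat \<Rightarrow> nat"
    have "\<exists>N. \<forall>ds'. \<not> ext i N ds'" for i
    proof -
      have "\<forall>j<n. (ds(n := i)) j = ds j" by simp
      hence "\<not> good (Suc n) (ds(n := i))" using contr by blast
      thus ?thesis unfolding good_def ext_def by blast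
    qed
    \<comment> \<open>With next direction i no path is open for \<open>F i\<close> steps; an open
      path as long as the sum of all \<open>F i\<close> contradicts this for its own next
      direction.\<close>
    then obtain F where F: "\<not> ext i (F i) ds'" for i ds' by metis
    obtain ds' where ds': "\<forall>j<n. ds' j = ds j" "\<forall>m. ds' m < D" "\<forall>m<(\<Sum>i<D. F i). \<omega> (\<kappa> ds' m)"
      using \<open>good n ds\<close> unfolding good_def by blast
    have "F (ds' n) \<le> (\<Sum>i<D. F i)" using ds' by (intro member_le_sum) auto
    moreover have "\<forall>j<Suc n. ds' j = (ds(n := ds' n)) j" using ds' by (auto simp: less_Suc_eq)
    ultimately have "ext (ds' n) (F (ds' n)) ds'"
      unfolding ext_def using ds'(2,3) by (meson less_le_trans)
    thus False using F by blast
  qed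
  have "\<exists>f. \<forall>n. good n (f n) \<and> (\<forall>j<n. f (Suc n) j = f n j)"
    by (rule dependent_nat_choice[where P = good and Q = "\<lambda>n ds ds'. \<forall>j<n. ds' j = ds j"])
      (use good_0 good_Suc in auto)
  then obtain f where f: "\<And>n. good n (f n)" "\<And>n j. j < n \<Longrightarrow> f (Suc n) j = f n j" by blast
  define ds where "ds j = f (Suc j) j" for j
  have f_ds: "j < n \<Longrightarrow> f n j = ds j" for n j
  proof (induction n)
    case (Suc n)
    thus ?case using f(2)[of j n] by (cases "j = n") (auto simp: ds_def)
  qed auto
  have "\<omega> (\<kappa> ds m) \<and> ds m < D" for m
  proof -
    obtain ds' where ds': "\<forall>j<Suc m. ds' j = f (Suc m) j" "\<forall>m. ds' m < D" "\<forall>k<Suc m. \<omega> (\<kappa> ds' k)"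
      using f(1)[of "Suc m"] unfolding good_def by blast
    have eq: "ds' j = ds j" if "j \<le> m" for j using ds'(1) f_ds that by auto
    hence "\<kappa> ds' m = \<kappa> ds m" by (intro \<kappa>_cong) auto
    thus ?thesis using ds' eq[of m] by (metis lessI order_refl)
  qed
  thus ?thesis by blast
qed

definition percolation_prob :: "real \<Rightarrow> real" where
  "percolation_prob p =
    \<P>(\<omega> in bernoulli_percolation I p. \<exists>ds. (\<forall>m. ds m < D) \<and> (\<forall>m. \<omega> (\<kappa> ds m)))"

abbreviation finite_path_prob :: "real \<Rightarrow> nat \<Rightarrow> real" where
  "finite_path_prob p N \<equiv> path_prob I p (path_sets D \<kappa> N) Map.empty"

lemma sets_hits: "{\<omega> \<in> space (bernoulli_percolation I p). hits (path_sets D \<kappa> N) \<omega>}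
    \<in> sets (bernoulli_percolation I p)"
  using measurable_hits[OF finitary_path_sets[of N], of Map.empty p] by simp

lemma percolation_prob_le: "percolation_prob p \<le> finite_path_prob p N"
proof -
  interpret prob_space "bernoulli_percolation I p" by (rule prob_space_bernoulli_percolation)
  show ?thesis unfolding percolation_prob_def path_prob_def
    using sets_hits by (intro finite_measure_mono) (auto simp: hits_path_sets)
qed

text \<open>Continuity from above: the finite-length events decrease, and by \<open>koenig\<close>
  their intersection is percolation. \<open>Suc N\<close> is what the site comparison provides, a
  path of N steps having N + 1 vertices.\<close>

lemma percolation_prob_ge:
  assumes "\<And>N. a \<le> finite_path_prob p (Suc N)"
  shows "a \<le> percolation_prob p"
proof -
  let ?M = "bernoulli_percolation I p"
  interpret prob_space ?M by (rule prob_space_bernoulli_percolation)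
  define A where "A N = {\<omega> \<in> space ?M. hits (path_sets D \<kappa> (Suc N)) \<omega>}" for N
  have "decseq A"
    by (rule decseq_SucI) (unfold A_def hits_path_sets, blast intro: less_SucI)
  moreover have "range A \<subseteq> sets ?M"
    using sets_hits by (auto simp: A_def)
  ultimately have "(\<lambda>N. prob (A N)) \<longlonglongrightarrow> prob (\<Inter>N. A N)"
    by (intro finite_Lim_measure_decseq) auto
  moreover have "a \<le> prob (A N)" for N
    using assms[of N] by (simp add: A_def path_prob_def)
  ultimately have "a \<le> prob (\<Inter>N. A N)"
    by (intro LIMSEQ_le_const) auto
  also have "(\<Inter>N. A N) = {\<omega> \<in> space ?M. \<exists>ds. (\<forall>m. ds m < D) \<and> (\<forall>m. \<omega> (\<kappa> ds m))}"
  proof (intro set_eqI iffI)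
    fix \<omega> assume "\<omega> \<in> (\<Inter>N. A N)"
    hence "\<omega> \<in> space ?M" "\<And>N. hits (path_sets D \<kappa> (Suc N)) \<omega>" by (auto simp: A_def)
    moreover from this(2) have "hits (path_sets D \<kappa> N) \<omega>" for N
      unfolding hits_path_sets by (meson less_SucI)
    ultimately have "\<omega> \<in> space ?M" "\<And>N. hits (path_sets D \<kappa> N) \<omega>" by auto
    thus "\<omega> \<in> {\<omega> \<in> space ?M. \<exists>ds. (\<forall>m. ds m < D) \<and> (\<forall>m. \<omega> (\<kappa> ds m))}"
      using koenig[of \<omega>] by blast
  qed (auto simp: A_def hits_path_sets)
  finally show ?thesis by (simp add: percolation_prob_def)
qed

lemma percolation_prob_nonneg: "0 \<le> percolation_prob p"
  by (simp add: percolation_prob_def)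

text \<open>Union bound over at most D^N sets, each of N distinct coordinates by
  \<open>\<kappa>_inj\<close>; then N tends to infinity.\<close>

lemma percolation_prob_eq_0:
  assumes "0 \<le> p" "p \<le> 1" "real D * p < 1"
  shows "percolation_prob p = 0"
proof -
  interpret prob_space "bernoulli_percolation I p" by (rule prob_space_bernoulli_percolation)
  have "percolation_prob p \<le> (real D * p) ^ N" for N
  proof -
    let ?S = "path_sets D \<kappa> N"
    let ?A = "\<lambda>P. {\<omega> \<in> space (bernoulli_percolation I p). \<forall>c\<in>P. \<omega> c = True}"
    have fin: "finite P" "P \<subseteq> I" "card P = N" if "P \<in> ?S" for P
    proof -
      show "finite P" "P \<subseteq> I" using that finitary_path_sets unfolding finitary_def by auto
      obtain ds where ds: "\<forall>m. ds m < D" "P = \<kappa> ds ` {..<N}" using \<open>P \<in> ?S\<close> by (auto simp: path_sets_def)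
      thus "card P = N" using \<kappa>_inj[of ds] by (simp add: card_image inj_on_subset)
    qed
    have A: "?A P \<in> events" if "P \<in> ?S" for P
      using measurable_hits[of I "{P}" Map.empty p] fin[OF that]
      by (simp add: hits_def finitary_def)
    have "percolation_prob p \<le> prob (\<Union>P\<in>?S. ?A P)"
      unfolding percolation_prob_def
    proof (intro finite_measure_mono subsetI)
      show "(\<Union>P\<in>?S. ?A P) \<in> events"
        using A path_sets_bound(1) by (intro sets.finite_UN) auto
      fix \<omega> assume "\<omega> \<in> {\<omega> \<in> space (bernoulli_percolation I p).
        \<exists>ds. (\<forall>m. ds m < D) \<and> (\<forall>m. \<omega> (\<kappa> ds m))}"
      then obtain ds where ds: "\<omega> \<in> space (bernoulli_percolation I p)" "\<forall>m. ds m < D"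
        "\<forall>m. \<omega> (\<kappa> ds m)" by blast
      hence "\<omega> \<in> ?A (\<kappa> ds ` {..<N})" by simp
      moreover have "\<kappa> ds ` {..<N} \<in> ?S" using ds by (auto simp: path_sets_def)
      ultimately show "\<omega> \<in> (\<Union>P\<in>?S. ?A P)" by blast
    qed
    also have "\<dots> \<le> (\<Sum>P\<in>?S. prob (?A P))"
      using A path_sets_bound(1) by (intro finite_measure_subadditive_finite) auto
    also have "\<dots> = (\<Sum>P\<in>?S. p ^ N)"
      using fin assms by (intro sum.cong refl, subst prob_all_equal) auto
    also have "\<dots> \<le> real (D ^ N) * p ^ N"
      using path_sets_bound(2)[of N] assms by (simp add: mult_right_mono)
    finally show ?thesis by (simp add: power_mult_distrib)
  qed
  moreover have "(\<lambda>N. (real D * p) ^ N) \<longlonglongrightarrow> 0"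
    using assms by (intro LIMSEQ_power_zero) auto
  ultimately have "percolation_prob p \<le> 0"
    by (intro LIMSEQ_le_const) auto
  thus ?thesis using percolation_prob_nonneg[of p] by simp
qed

end

section \<open>Sites and bonds as instances of the model\<close>

lemma inj_walk:
  assumes "\<And>j. ds j < d"
  shows "inj (walk ds)"
proof (rule injI)
  fix m n assume "walk ds m = walk ds n"
  hence "level d (walk ds m) = level d (walk ds n)" by (rule arg_cong)
  thus "m = n" using assms by (simp add: level_walk)
qed

lemma site_model:
  assumes "0 < d"
  shows "percolation_model d (lattice d) walk"
proof
  show "walk ds m = walk ds' m" if "\<And>j. j \<le> m \<Longrightarrow> ds j = ds' j" for ds ds' m
    by (rule walk_cong, rule that, rule less_imp_le)
  show "walk ds m \<in> lattice d" if "\<And>j. ds j < d" for ds m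
    by (rule walk_in_lattice, rule that)
  show "inj (walk ds)" if "\<And>j. ds j < d" for ds
    by (rule inj_walk, rule that)
qed fact

definition bond_walk :: "(nat \<Rightarrow> nat) \<Rightarrow> nat \<Rightarrow> (nat \<Rightarrow> nat) \<times> (nat \<Rightarrow> nat)" where
  "bond_walk ds m = (walk ds m, walk ds (Suc m))"

lemma oriented_edges_step: "oriented_edges d = {(x, step x i) | x i. x \<in> lattice d \<and> i < d}"
  by (simp add: oriented_edges_def step_def)

lemma bond_model:
  assumes "0 < d"
  shows "percolation_model d (oriented_edges d) bond_walk"
proof
  show "bond_walk ds m = bond_walk ds' m" if "\<And>j. j \<le> m \<Longrightarrow> ds j = ds' j" for ds ds' m
  proof -
    have "walk ds m = walk ds' m" by (rule walk_cong, rule that, rule less_imp_le)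
    thus ?thesis by (simp add: bond_walk_def that)
  qed
  show "bond_walk ds m \<in> oriented_edges d" if "\<And>j. ds j < d" for ds m
    using walk_in_lattice[of m ds d] that by (auto simp: bond_walk_def oriented_edges_step)
  show "inj (bond_walk ds)" if "\<And>j. ds j < d" for ds
    using inj_walk[of ds d, OF that] by (simp add: bond_walk_def inj_def)
qed fact

lemma site_percolation_prob_eq:
  assumes "0 < d"
  shows "site_percolation_prob d p = percolation_model.percolation_prob d (lattice d) walk p"
proof -
  have "(\<exists>v. oriented_path d v \<and> (\<forall>n. \<omega> (v n))) \<longleftrightarrow> (\<exists>ds. (\<forall>m. ds m < d) \<and> (\<forall>m. \<omega> (walk ds m)))" for \<omega>
    unfolding oriented_path_iff_walk by blast
  thus ?thesis
    unfolding percolation_model.percolation_prob_def[OF site_model[OF assms]] site_percolation_prob_def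
    by simp
qed

lemma bond_percolation_prob_eq:
  assumes "0 < d"
  shows "bond_percolation_prob d p =
    percolation_model.percolation_prob d (oriented_edges d) bond_walk p"
proof -
  have "(\<exists>v. oriented_path d v \<and> (\<forall>n. \<omega> (v n, v (Suc n)))) \<longleftrightarrow>
      (\<exists>ds. (\<forall>m. ds m < d) \<and> (\<forall>m. \<omega> (bond_walk ds m)))" for \<omega>
    unfolding oriented_path_iff_walk bond_walk_def by blast
  thus ?thesis
    unfolding percolation_model.percolation_prob_def[OF bond_model[OF assms]] bond_percolation_prob_def
    by simp
qed

section \<open>Lifting the exploration to one more dimension\<close>

text \<open>\<open>a\<close> is 1 for sites and 0 for bonds: arriving at time n takes n + 1 open
  vertices, the origin included, or n open edges. Only coordinates revealed as open count.\<close>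

definition reached ::
    "nat \<Rightarrow> ((nat \<Rightarrow> nat) \<Rightarrow> nat \<Rightarrow> 'c) \<Rightarrow> nat \<Rightarrow> ('c \<rightharpoonup> bool) \<Rightarrow> (nat \<Rightarrow> nat) \<Rightarrow> bool" where
  "reached D \<kappa> a \<rho> x \<longleftrightarrow>
    (\<exists>ds n. (\<forall>m. ds m < D) \<and> (\<forall>m<n + a. \<rho> (\<kappa> ds m) = Some True) \<and> walk ds n = x)"

lemma reached_mono:
  "reached D \<kappa> a \<rho> x \<Longrightarrow> (\<And>c. \<rho> c = Some True \<Longrightarrow> \<rho>' c = Some True) \<Longrightarrow> reached D \<kappa> a \<rho>' x"
  unfolding reached_def by blast

text \<open>The path to \<open>x\<close> is redirected at its last time n; positions up to time n
  depend on earlier directions only.\<close>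

lemma site_reached_step:
  assumes "reached D walk 1 \<rho> x" "i < D" "\<rho> (step x i) = Some True"
  shows "reached D walk 1 \<rho> (step x i)"
proof -
  obtain ds n where ds: "\<forall>m. ds m < D" "\<forall>m<n + 1. \<rho> (walk ds m) = Some True" "walk ds n = x"
    using assms(1) unfolding reached_def by blast
  let ?ds = "ds(n := i)"
  have eq: "walk ?ds m = walk ds m" if "m \<le> n" for m
    using that by (intro walk_cong) auto
  hence last: "walk ?ds (Suc n) = step x i" using ds by simp
  have "\<rho> (walk ?ds m) = Some True" if "m < Suc n + 1" for m
    using that ds(2) assms(3) last eq[of m] by (cases "m = Suc n") auto
  moreover have "\<forall>m. ?ds m < D" using ds assms(2) by simp
  ultimately show ?thesis unfolding reached_def using last by blast
qed

lemma bond_reached_step: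
  assumes "reached D bond_walk 0 \<rho> x" "i < D" "\<rho> (x, step x i) = Some True"
  shows "reached D bond_walk 0 \<rho> (step x i)"
proof -
  obtain ds n where ds: "\<forall>m. ds m < D" "\<forall>m<n + 0. \<rho> (bond_walk ds m) = Some True" "walk ds n = x"
    using assms(1) unfolding reached_def by blast
  let ?ds = "ds(n := i)"
  have eq: "walk ?ds m = walk ds m" if "m \<le> n" for m
    using that by (intro walk_cong) auto
  hence last: "walk ?ds (Suc n) = step x i" using ds by simp
  have "\<rho> (bond_walk ?ds m) = Some True" if "m < Suc n + 0" for m
  proof (cases "m = n")
    case True
    thus ?thesis using last eq[of n] ds(3) assms(3) by (simp only: bond_walk_def)
  next
    case False
    hence "bond_walk ?ds m = bond_walk ds m"
      using that eq[of m] eq[of "Suc m"] unfolding bond_walk_def by simp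
    thus ?thesis using ds(2) False that by simp
  qed
  moreover have "\<forall>m. ?ds m < D" using ds assms(2) by simp
  ultimately show ?thesis unfolding reached_def using last by blast
qed

text \<open>The level of \<open>x\<close> is the length of its path, which therefore has at least
  \<open>N\<close> coordinates revealed as open, whatever the hidden ones are.\<close>

lemma path_prob_reached:
  assumes "reached D \<kappa> a \<rho> x" "N \<le> level D x + a"
  shows "path_prob I p (path_sets D \<kappa> N) \<rho> = 1"
proof -
  interpret prob_space "bernoulli_percolation I p" by (rule prob_space_bernoulli_percolation)
  obtain ds n where ds: "\<forall>m. ds m < D" "\<forall>m<n + a. \<rho> (\<kappa> ds m) = Some True" "walk ds n = x"
    using assms(1) unfolding reached_def by blast
  hence "level D x = n" using level_walk by blast
  hence "\<forall>m<N. override \<rho> \<omega> (\<kappa> ds m)" for \<omega>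
    using ds(2) assms(2) by (auto simp: override_def)
  hence "hits (path_sets D \<kappa> N) (override \<rho> \<omega>)" for \<omega>
    unfolding hits_path_sets using ds(1) by blast
  thus ?thesis by (simp add: path_prob_def prob_space)
qed

section \<open>Geometry of the lifted vertices\<close>

lemma level_lift: "level (Suc d) (x(d := h)) = level d x + h"
  by (simp add: level_def)

lemma lift_eq_iff:
  assumes "x \<in> lattice d" "y \<in> lattice d"
  shows "x(d := h) = y(d := h') \<longleftrightarrow> x = y \<and> h = h'"
proof
  assume eq: "x(d := h) = y(d := h')"
  have "h = h'" using fun_cong[OF eq, of d] by simp
  moreover have "x j = y j" for j
    using fun_cong[OF eq, of j] assms by (cases "j = d") (auto simp: lattice_def)
  ultimately show "x = y \<and> h = h'" by auto
qed auto

lemma lift_in_lattice: "x \<in> lattice d \<Longrightarrow> x(d := h) \<in> lattice (d + 1)"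
  by (auto simp: lattice_def)

lemma step_lift: "i < d \<Longrightarrow> step (x(d := h)) i = (step x i)(d := h)"
  by (auto simp: step_def unit_vector_def fun_eq_iff)

lemma step_lift_up: "step (x(d := h)) d = x(d := Suc h)"
  by (auto simp: step_def unit_vector_def fun_eq_iff)

lemma inj_step: "inj (step x)"
proof (rule injI)
  fix i j assume "step x i = step x j"
  from fun_cong[OF this, of i] show "i = j"
    by (simp add: step_def unit_vector_def split: if_splits)
qed

lemma step_eq_iff [simp]: "step x i = step x j \<longleftrightarrow> i = j"
  using inj_step by (auto dest: injD)

lemma step_neq [simp]: "step x i \<noteq> x" "x \<noteq> step x i"
proof -
  show "step x i \<noteq> x"
  proof
    assume "step x i = x"
    from fun_cong[OF this, of i] show False by (simp add: step_def unit_vector_def)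
  qed
  thus "x \<noteq> step x i" by metis
qed

lemma reveal_eq_None: "reveal c D S \<sigma> z = None \<longleftrightarrow> z \<notin> c ` D \<and> \<sigma> z = None"
  by (simp add: reveal_def)

lemma reveal_extends:
  "(\<And>i. i \<in> D \<Longrightarrow> \<sigma> (c i) = None) \<Longrightarrow> \<sigma> z = Some b \<Longrightarrow> reveal c D S \<sigma> z = Some b"
  unfolding reveal_def by (metis image_iff option.distinct(1))

lemma reveal_cases_True:
  assumes "reveal c D S \<sigma> z = Some True"
  obtains i where "i \<in> S" "z = c i" | "z \<notin> c ` D" "\<sigma> z = Some True"
  using assms by (auto simp: reveal_def split: if_splits)

text \<open>\<open>\<sigma>\<close> and \<open>\<rho>\<close> record the examined vertices in dimensions \<open>d\<close> and \<open>d + 1\<close>, and \<open>x(d := k x)\<close> is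
  the lift of \<open>x\<close>. The last two conditions provide unexamined vertices for the next step.\<close>

definition site_inv :: "nat \<Rightarrow> ((nat \<Rightarrow> nat) \<rightharpoonup> bool) \<Rightarrow> ((nat \<Rightarrow> nat) \<rightharpoonup> bool) \<Rightarrow>
    ((nat \<Rightarrow> nat) \<Rightarrow> nat) \<Rightarrow> bool" where
  "site_inv d \<sigma> \<rho> k \<longleftrightarrow>
    \<sigma> origin = Some True \<and>
    (\<forall>x. \<sigma> x = Some True \<longrightarrow> x \<in> lattice d \<and> reached (d + 1) walk 1 \<rho> (x(d := k x))) \<and>
    (\<forall>y\<in>lattice d. \<forall>h. \<sigma> y = None \<longrightarrow> \<rho> (y(d := h)) = None) \<and>
    (\<forall>x i h. \<sigma> x = Some True \<longrightarrow> i < d \<longrightarrow> \<sigma> (step x i) = None \<longrightarrow> k x < h \<longrightarrow> \<rho> (x(d := h)) = None)"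

text \<open>\<open>B\<close> is what was found open at height \<open>k x\<close>, \<open>T\<close>
  is the second-chance block with open part \<open>U\<close>, and \<open>S\<close> is what is
  declared open in dimension d. Unless \<open>S = B\<close>, all of \<open>T\<close> is open, and
  the failed neighbours in \<open>S\<close> are reached through
  \<open>x(d := Suc (k x))\<close>.\<close>

lemma site_inv_step:
  assumes inv: "site_inv d \<sigma> \<rho> k" and x: "\<sigma> x = Some True"
    and D: "D = {i. i < d \<and> \<sigma> (step x i) = None}" and "D \<noteq> {}"
    and B: "B \<subseteq> S" "S \<subseteq> D"
    and T: "T = insert (x(d := Suc (k x))) ((\<lambda>i. (step x i)(d := Suc (k x))) ` (D - B))"
    and U: "U \<subseteq> T" "S = B \<or> U = T"
  shows "\<exists>k'. site_inv d (reveal (step x) D S \<sigma>)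
    (reveal id T U (reveal (\<lambda>i. (step x i)(d := k x)) D B \<rho>)) k'"
proof -
  let ?g = "\<lambda>i. (step x i)(d := k x)"
  define \<sigma>' where "\<sigma>' = reveal (step x) D S \<sigma>"
  define \<rho>' where "\<rho>' = reveal id T U (reveal ?g D B \<rho>)"
  \<comment> \<open>The lift over a newly examined neighbour is the highest vertex just examined in
    its column, so that everything above stays hidden.\<close>
  define k' where "k' y = (if y \<in> step x ` B then k x else if y \<in> step x ` D then Suc (k x) else k y)" for y
  from inv have origin: "\<sigma> origin = Some True"
    and lift: "\<And>z. \<sigma> z = Some True \<Longrightarrow> z \<in> lattice d \<and> reached (d + 1) walk 1 \<rho> (z(d := k z))"
    and col: "\<And>y h. y \<in> lattice d \<Longrightarrow> \<sigma> y = None \<Longrightarrow> \<rho> (y(d := h)) = None"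
    and above: "\<And>z i h. \<sigma> z = Some True \<Longrightarrow> i < d \<Longrightarrow> \<sigma> (step z i) = None \<Longrightarrow> k z < h \<Longrightarrow>
      \<rho> (z(d := h)) = None"
    unfolding site_inv_def by blast+
  have x_lat: "x \<in> lattice d" using lift[OF x] by blast
  have step_lat: "step x i \<in> lattice d" if "i \<in> D" for i
    using that x_lat D by (auto intro: step_in_lattice)
  have T_cases: "z = x \<and> h = Suc (k x) \<or> (\<exists>i\<in>D - B. z = step x i \<and> h = Suc (k x))"
    if "z(d := h) \<in> T" "z \<in> lattice d" for z h
    using that x_lat step_lat by (auto simp: T lift_eq_iff)
  have g_cases: "\<exists>i\<in>D. z = step x i \<and> h = k x" if "z(d := h) \<in> ?g ` D" "z \<in> lattice d" for z h
    using that step_lat by (auto simp: lift_eq_iff)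
  have g_None: "\<rho> (?g i) = None" if "i \<in> D" for i
    using that col step_lat D by auto
  have T_None: "\<rho> e = None" if "e \<in> T" for e
  proof -
    obtain i where "i \<in> D" using \<open>D \<noteq> {}\<close> by blast
    hence "\<rho> (x(d := Suc (k x))) = None" using above[OF x, of i] D by auto
    moreover have "\<rho> ((step x i)(d := Suc (k x))) = None" if "i \<in> D" for i
      using that col step_lat D by auto
    ultimately show ?thesis using that unfolding T by auto
  qed
  have g_notin_T: "?g i \<notin> T" if "i \<in> D" for i
    using T_cases[OF _ step_lat[OF that], of "k x"] by auto
  have \<rho>'_ext: "\<rho>' z = Some True" if "\<rho> z = Some True" for z
    using that T_None g_None unfolding \<rho>'_def by (auto simp: reveal_def)
  have x_reached: "reached (d + 1) walk 1 \<rho>' (x(d := k x))"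
    using lift[OF x] \<rho>'_ext by (auto intro: reached_mono)
  have "site_inv d \<sigma>' \<rho>' k'"
    unfolding site_inv_def
  proof (intro conjI allI impI ballI)
    show "\<sigma>' origin = Some True"
      using origin D unfolding \<sigma>'_def by (auto intro: reveal_extends)
  next
    fix z assume "\<sigma>' z = Some True"
    thus z_lat: "z \<in> lattice d"
      unfolding \<sigma>'_def by (rule reveal_cases_True) (use step_lat lift B in auto)
    from \<open>\<sigma>' z = Some True\<close> show "reached (d + 1) walk 1 \<rho>' (z(d := k' z))"
      unfolding \<sigma>'_def
    proof (rule reveal_cases_True)
      fix i assume i: "i \<in> S" "z = step x i"
      hence "i \<in> D" "i < d" using B D by auto
      show ?thesis
      proof (cases "i \<in> B")
        case True
        have "\<rho>' (?g i) = Some True"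
          using True B g_notin_T[OF \<open>i \<in> D\<close>] unfolding \<rho>'_def by (auto simp: reveal_def)
        hence "reached (d + 1) walk 1 \<rho>' (?g i)"
          using site_reached_step[OF x_reached, of i] \<open>i < d\<close> by (simp add: step_lift)
        thus ?thesis using True i by (simp add: k'_def)
      next
        case False
        hence "U = T" using i U by auto
        hence T_True: "\<rho>' e = Some True" if "e \<in> T" for e
          using that unfolding \<rho>'_def by (simp add: reveal_def)
        have up: "reached (d + 1) walk 1 \<rho>' (x(d := Suc (k x)))"
          using site_reached_step[OF x_reached, of d] T_True[of "x(d := Suc (k x))"]
          by (simp add: step_lift_up T)
        have "(step x i)(d := Suc (k x)) \<in> T" using False \<open>i \<in> D\<close> by (auto simp: T)
        hence "reached (d + 1) walk 1 \<rho>' ((step x i)(d := Suc (k x)))"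
          using site_reached_step[OF up, of i] T_True \<open>i < d\<close> by (simp add: step_lift)
        moreover have "k' z = Suc (k x)" using False i \<open>i \<in> D\<close> by (auto simp: k'_def)
        ultimately show ?thesis using i by simp
      qed
    next
      assume z: "z \<notin> step x ` D" "\<sigma> z = Some True"
      have "z \<notin> step x ` B" using z B by auto
      thus ?thesis using z lift[OF z(2)] \<rho>'_ext by (auto simp: k'_def intro: reached_mono)
    qed
  next
    fix y h assume y: "y \<in> lattice d" "\<sigma>' y = None"
    hence y': "y \<notin> step x ` D" "\<sigma> y = None" by (auto simp: \<sigma>'_def reveal_eq_None)
    hence "y \<noteq> x" using x by auto
    thus "\<rho>' (y(d := h)) = None"
      using y' y col T_cases[of y h] g_cases[of y h] unfolding \<rho>'_def reveal_eq_None by fastforce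
  next
    fix z i h assume z: "\<sigma>' z = Some True" "i < d" "\<sigma>' (step z i) = None" "k' z < h"
    have z_None: "\<sigma> (step z i) = None" "step z i \<notin> step x ` D"
      using z(3) by (auto simp: \<sigma>'_def reveal_eq_None)
    \<comment> \<open>All hidden out-neighbours of \<open>x\<close> were in \<open>D\<close>, so
      nothing will be asked from \<open>x\<close> again and its column may lose the vertex at height
      \<open>Suc (k x)\<close>.\<close>
    hence "z \<noteq> x" using D z(2) by auto
    from z(1) show "\<rho>' (z(d := h)) = None"
      unfolding \<sigma>'_def
    proof (rule reveal_cases_True)
      fix j assume j: "j \<in> S" "z = step x j"
      hence "j \<in> D" using B by auto
      have "\<rho> (z(d := h)) = None" using col step_lat[OF \<open>j \<in> D\<close>] \<open>j \<in> D\<close> D j by auto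
      moreover have "z(d := h) \<notin> T"
        using T_cases[of z h] \<open>z \<noteq> x\<close> z(4) j step_lat[OF \<open>j \<in> D\<close>] \<open>j \<in> D\<close>
        by (auto simp: k'_def split: if_splits)
      moreover have "z(d := h) \<notin> ?g ` D"
        using g_cases[of z h] z(4) j step_lat[OF \<open>j \<in> D\<close>] \<open>j \<in> D\<close>
        by (auto simp: k'_def split: if_splits)
      ultimately show ?thesis unfolding \<rho>'_def reveal_eq_None by simp
    next
      assume z': "z \<notin> step x ` D" "\<sigma> z = Some True"
      have z_lat: "z \<in> lattice d" using lift z' by blast
      have "k' z = k z" using z' B by (auto simp: k'_def)
      hence "\<rho> (z(d := h)) = None" using above[OF z'(2) z(2) z_None(1)] z(4) by simp
      moreover have "z(d := h) \<notin> T" using T_cases[OF _ z_lat] \<open>z \<noteq> x\<close> z' by blast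
      moreover have "z(d := h) \<notin> ?g ` D" using g_cases[OF _ z_lat] z' by blast
      ultimately show ?thesis unfolding \<rho>'_def reveal_eq_None by simp
    qed
  qed
  thus ?thesis unfolding \<sigma>'_def \<rho>'_def by blast
qed

lemma path_prob_eq_0:
  assumes "\<And>\<omega>. \<not> hits \<P> (override \<sigma> \<omega>)"
  shows "path_prob I p \<P> \<sigma> = 0"
  using assms by (simp add: path_prob_def)

lemma card_undetermined_less:
  assumes "finite X" "\<And>z. z \<in> X \<Longrightarrow> \<sigma>' z = None \<Longrightarrow> \<sigma> z = None" "z \<in> X" "\<sigma> z = None" "\<sigma>' z \<noteq> None"
  shows "card {z \<in> X. \<sigma>' z = None} < card {z \<in> X. \<sigma> z = None}"
proof (rule psubset_card_mono)
  have "z \<in> {z \<in> X. \<sigma> z = None} - {z \<in> X. \<sigma>' z = None}" using assms by simp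
  thus "{z \<in> X. \<sigma>' z = None} \<subset> {z \<in> X. \<sigma> z = None}" using assms(2) by blast
qed (use assms in simp)

text \<open>Induction on the number of hidden vertices up to level \<open>N\<close>. While an open
  vertex below level \<open>N\<close> has hidden out-neighbours, they are revealed by
  \<open>path_prob_reveal_step\<close>, whose two comparisons are induction hypotheses. Afterwards
  an open path either is impossible, and the left side is 0, or is completely revealed with its
  endpoint lifted, and the right side is 1.\<close>

lemma site_domination_step:
  assumes p: "0 \<le> p" "p \<le> 1" and \<epsilon>: "0 \<le> \<epsilon>" "\<epsilon> \<le> 1" "real d * \<epsilon> \<le> p ^ (d + 1)" and "0 < d"
    and inv: "site_inv d \<sigma> \<rho> k"
  shows "path_prob (lattice d) (p + \<epsilon> * (1 - p)) (path_sets d walk (Suc N)) \<sigma> \<le>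
    path_prob (lattice (d + 1)) p (path_sets (d + 1) walk (Suc N)) \<rho>"
  using inv
proof (induction "card {x \<in> {x \<in> lattice d. level d x \<le> N}. \<sigma> x = None}" arbitrary: \<sigma> \<rho> k
    rule: less_induct)
  case less
  have origin: "\<sigma> origin = Some True"
    and lift: "\<And>z. \<sigma> z = Some True \<Longrightarrow> z \<in> lattice d \<and> reached (d + 1) walk 1 \<rho> (z(d := k z))"
    and col: "\<And>y h. y \<in> lattice d \<Longrightarrow> \<sigma> y = None \<Longrightarrow> \<rho> (y(d := h)) = None"
    and above: "\<And>z i h. \<sigma> z = Some True \<Longrightarrow> i < d \<Longrightarrow> \<sigma> (step z i) = None \<Longrightarrow> k z < h \<Longrightarrow>
      \<rho> (z(d := h)) = None"
    using less.prems unfolding site_inv_def by blast+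
  show ?case
  proof (cases "\<exists>x i. \<sigma> x = Some True \<and> level d x < N \<and> i < d \<and> \<sigma> (step x i) = None")
    case True
    then obtain x i where x: "\<sigma> x = Some True" and i: "level d x < N" "i < d" "\<sigma> (step x i) = None"
      by blast
    have x_lat: "x \<in> lattice d" using lift[OF x] by blast
    define D where "D = {i. i < d \<and> \<sigma> (step x i) = None}"
    have D: "finite D" "D \<subseteq> {..<d}" "i \<in> D" using i by (auto simp: D_def)
    have cardD: "card D \<le> d" using card_mono[OF _ D(2)] by simp
    have step_lat: "step x j \<in> lattice d" if "j \<in> D" for j
      using that x_lat D by (auto intro: step_in_lattice)
    define T where "T B = insert (x(d := Suc (k x))) ((\<lambda>i. (step x i)(d := Suc (k x))) ` (D - B))" for B
    let ?g = "\<lambda>i. (step x i)(d := k x)"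
    have ineq: "path_prob (lattice d) (p + \<epsilon> * (1 - p)) (path_sets d walk (Suc N)) (reveal (step x) D S \<sigma>)
        \<le> path_prob (lattice (d + 1)) p (path_sets (d + 1) walk (Suc N))
          (reveal id (T B) U (reveal ?g D B \<rho>))"
      if BSU: "B \<subseteq> S" "S \<subseteq> D" "U \<subseteq> T B" "S = B \<or> U = T B" for B S U
    proof -
      have "D \<noteq> {}" using D by auto
      obtain k' where k': "site_inv d (reveal (step x) D S \<sigma>) (reveal id (T B) U (reveal ?g D B \<rho>)) k'"
        using site_inv_step[OF less.prems x D_def \<open>D \<noteq> {}\<close> BSU(1,2) T_def BSU(3,4)] by blast
      show ?thesis
      proof (rule less.hyps[OF _ k'], rule card_undetermined_less)
        show "finite {x \<in> lattice d. level d x \<le> N}" by (rule finite_level_le)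
        show "step x i \<in> {x \<in> lattice d. level d x \<le> N}"
          using i step_lat[OF D(3)] by (simp add: level_step)
        show "\<sigma> (step x i) = None" by fact
        show "reveal (step x) D S \<sigma> (step x i) \<noteq> None"
          using D by (simp add: reveal_eq_None)
      qed (simp add: reveal_eq_None)
    qed
    show ?thesis
    proof (rule path_prob_reveal_step[where d = d and D = D and c = "step x" and g = ?g and T = T])
      show "finitary (lattice d) (path_sets d walk (Suc N))"
        by (rule percolation_model.finitary_path_sets[OF site_model]) fact
      show "finitary (lattice (d + 1)) (path_sets (d + 1) walk (Suc N))"
        by (rule percolation_model.finitary_path_sets[OF site_model]) simp
      show "inj_on (step x) D" by (simp add: inj_on_def)
      show "step x ` D \<subseteq> lattice d" using step_lat by blast
      show "\<sigma> (step x j) = None" if "j \<in> D" for j using that by (simp add: D_def)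
      show "inj_on ?g D"
        using step_lat by (auto simp: inj_on_def lift_eq_iff)
      show "?g ` D \<subseteq> lattice (d + 1)"
        using step_lat lift_in_lattice by blast
      show "\<rho> (?g j) = None" if "j \<in> D" for j
        using that step_lat col by (auto simp: D_def)
      show "finite (T B) \<and> T B \<subseteq> lattice (d + 1) \<and> card (T B) \<le> d + 1 \<and> T B \<inter> ?g ` D = {}"
        if "B \<subseteq> D" for B
      proof (intro conjI)
        show "finite (T B)" using D by (simp add: T_def)
        show "T B \<subseteq> lattice (d + 1)"
          using x_lat step_lat lift_in_lattice unfolding T_def by blast
        have "card (T B) \<le> Suc (card ((\<lambda>i. (step x i)(d := Suc (k x))) ` (D - B)))"
          unfolding T_def by (rule card_insert_le_m1) auto
        also have "\<dots> \<le> Suc (card D)"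
          using D by (meson Suc_le_mono card_image_le card_mono finite_Diff Diff_subset le_trans)
        finally show "card (T B) \<le> d + 1" using cardD by simp
        show "T B \<inter> ?g ` D = {}"
          using x_lat step_lat by (auto simp: T_def lift_eq_iff)
      qed
      show "\<rho> e = None" if "B \<subseteq> D" "e \<in> T B" for B e
        using that above[OF x i(2,3)] col step_lat unfolding T_def by (auto simp: D_def)
      show "path_prob (lattice d) (p + \<epsilon> * (1 - p)) (path_sets d walk (Suc N)) (reveal (step x) D B \<sigma>)
          \<le> path_prob (lattice (d + 1)) p (path_sets (d + 1) walk (Suc N))
            (reveal id (T B) U (reveal ?g D B \<rho>))" if "B \<subseteq> D" "U \<subseteq> T B" for B U
        using ineq[of B B U] that by blast
      show "path_prob (lattice d) (p + \<epsilon> * (1 - p)) (path_sets d walk (Suc N)) (reveal (step x) D D \<sigma>)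
          \<le> path_prob (lattice (d + 1)) p (path_sets (d + 1) walk (Suc N))
            (reveal id (T B) (T B) (reveal ?g D B \<rho>))" if "B \<subseteq> D" for B
        using ineq[of B D "T B"] that by blast
    qed (fact p \<epsilon> D(1) cardD)+
  next
    case False
    show ?thesis
    proof (cases "\<exists>\<omega>. hits (path_sets d walk (Suc N)) (override \<sigma> \<omega>)")
      case True
      then obtain \<omega> ds where ds: "\<And>m. ds m < d" "\<And>m. m \<le> N \<Longrightarrow> override \<sigma> \<omega> (walk ds m)"
        unfolding hits_path_sets by (auto simp: less_Suc_eq_le)
      have "\<sigma> (walk ds m) = Some True" if "m \<le> N" for m
        using that
      proof (induction m)
        case (Suc m)
        have "level d (walk ds m) = m" using ds(1) by (simp add: level_walk)
        hence "\<sigma> (walk ds (Suc m)) \<noteq> None" using Suc False ds(1)[of m] by auto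
        thus ?case using ds(2)[OF Suc.prems] by (auto simp: override_def)
      qed (simp add: origin)
      hence "reached (d + 1) walk 1 \<rho> ((walk ds N)(d := k (walk ds N)))"
        using lift by blast
      moreover have "level d (walk ds N) = N" using ds(1) by (simp add: level_walk)
      ultimately have "path_prob (lattice (d + 1)) p (path_sets (d + 1) walk (Suc N)) \<rho> = 1"
        by (intro path_prob_reached) (auto simp: level_lift)
      thus ?thesis by (simp add: path_prob_le_1)
    next
      case False
      thus ?thesis by (simp add: path_prob_eq_0 path_prob_nonneg)
    qed
  qed
qed

lemma path_prob_open_ge:
  assumes "finitary I \<P>" "c \<in> I" "\<sigma> c = None" "0 \<le> p" "p \<le> 1"
  shows "p * path_prob I p \<P> (\<sigma>(c \<mapsto> True)) \<le> path_prob I p \<P> \<sigma>"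
  using path_prob_split[where \<sigma> = \<sigma> and c = c, OF assms] assms(4,5) path_prob_nonneg[of I p \<P> "\<sigma>(c \<mapsto> False)"] by simp

text \<open>The factor \<open>p\<close> pays for the open origin in dimension d + 1, while in
  dimension d the origin is opened for free. Both explorations start with the origin
  revealed.\<close>

theorem site_domination:
  assumes p: "0 < p" "p \<le> 1" and \<epsilon>: "0 \<le> \<epsilon>" "\<epsilon> \<le> 1" "real d * \<epsilon> \<le> p ^ (d + 1)" and "0 < d"
  shows "p * site_percolation_prob d (p + \<epsilon> * (1 - p)) \<le> site_percolation_prob (d + 1) p"
proof -
  interpret M: percolation_model d "lattice d" walk by (rule site_model) fact
  interpret N: percolation_model "d + 1" "lattice (d + 1)" walk by (rule site_model) simp
  let ?p = "p + \<epsilon> * (1 - p)" and ?o = "Map.empty(origin \<mapsto> True)"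
  have inv: "site_inv d ?o ?o (\<lambda>_. 0)"
  proof -
    have "origin(d := 0) = origin" by (simp add: origin_def fun_eq_iff)
    moreover have "reached (d + 1) walk 1 ?o origin"
      unfolding reached_def by (rule exI[of _ "\<lambda>_. 0"], rule exI[of _ 0]) simp
    moreover have "y(d := h) \<noteq> origin" if "y \<in> lattice d" "y \<noteq> origin" for y h
      using that lift_eq_iff[of y d origin h 0] \<open>origin(d := 0) = origin\<close> by auto
    moreover have "origin(d := h) \<noteq> origin" if "0 < h" for h
      using that by (auto simp: origin_def fun_eq_iff)
    ultimately show ?thesis unfolding site_inv_def by (auto split: if_splits)
  qed
  have "p * M.percolation_prob ?p \<le> N.finite_path_prob p (Suc n)" for n
  proof -
    have "M.percolation_prob ?p \<le> M.finite_path_prob ?p (Suc n)"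
      by (rule M.percolation_prob_le)
    also have "\<dots> \<le> path_prob (lattice d) ?p (path_sets d walk (Suc n)) ?o"
      by (rule path_prob_mono[OF M.finitary_path_sets]) (auto simp: override_def)
    also have "\<dots> \<le> path_prob (lattice (d + 1)) p (path_sets (d + 1) walk (Suc n)) ?o"
      using p \<epsilon> \<open>0 < d\<close> by (intro site_domination_step[OF _ _ _ _ _ _ inv]) auto
    finally have "p * M.percolation_prob ?p \<le> p * \<dots>"
      using p by (intro mult_left_mono) auto
    also have "\<dots> \<le> N.finite_path_prob p (Suc n)"
      using p by (intro path_prob_open_ge N.finitary_path_sets) auto
    finally show ?thesis .
  qed
  hence "p * M.percolation_prob ?p \<le> N.percolation_prob p"
    by (rule N.percolation_prob_ge)
  thus ?thesis using \<open>0 < d\<close> by (simp add: site_percolation_prob_eq)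
qed

text \<open>Counterpart of \<open>site_inv\<close>. An edge is examined from its tail only, so one
  freshness condition suffices: while some out-edge of \<open>x\<close> is hidden, every edge
  starting in the column over \<open>x\<close> is hidden. \<open>A\<close> holds the reached
  vertices, which \<open>\<sigma>\<close>, a map on edges, does not list.\<close>

definition bond_inv :: "nat \<Rightarrow> ((nat \<Rightarrow> nat) \<times> (nat \<Rightarrow> nat) \<rightharpoonup> bool) \<Rightarrow>
    ((nat \<Rightarrow> nat) \<times> (nat \<Rightarrow> nat) \<rightharpoonup> bool) \<Rightarrow> (nat \<Rightarrow> nat) set \<Rightarrow> ((nat \<Rightarrow> nat) \<Rightarrow> nat) \<Rightarrow> bool" where
  "bond_inv d \<sigma> \<rho> A k \<longleftrightarrow>
    origin \<in> A \<and>
    (\<forall>x\<in>A. x \<in> lattice d \<and> reached (d + 1) bond_walk 0 \<rho> (x(d := k x))) \<and>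
    (\<forall>x i. \<sigma> (x, step x i) \<noteq> None \<longrightarrow> x \<in> A) \<and>
    (\<forall>x i. \<sigma> (x, step x i) = Some True \<longrightarrow> i < d \<longrightarrow> step x i \<in> A) \<and>
    (\<forall>x\<in>lattice d. \<forall>i<d. \<forall>h z. \<sigma> (x, step x i) = None \<longrightarrow> \<rho> (x(d := h), z) = None)"

lemma bond_inv_step:
  assumes inv: "bond_inv d \<sigma> \<rho> A k" and x: "x \<in> A"
    and D: "D = {i. i < d \<and> \<sigma> (x, step x i) = None}" and "D \<noteq> {}"
    and B: "B \<subseteq> S" "S \<subseteq> D"
    and T: "T = insert (x(d := k x), x(d := Suc (k x)))
      ((\<lambda>i. (x(d := Suc (k x)), (step x i)(d := Suc (k x)))) ` (D - B))"
    and U: "U \<subseteq> T" "S = B \<or> U = T"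
  shows "\<exists>A' k'. bond_inv d (reveal (\<lambda>i. (x, step x i)) D S \<sigma>)
    (reveal id T U (reveal (\<lambda>i. (x(d := k x), (step x i)(d := k x))) D B \<rho>)) A' k'"
proof -
  let ?c = "\<lambda>i. (x, step x i)" and ?g = "\<lambda>i. (x(d := k x), (step x i)(d := k x))"
  define \<sigma>' where "\<sigma>' = reveal ?c D S \<sigma>"
  define \<rho>' where "\<rho>' = reveal id T U (reveal ?g D B \<rho>)"
  define A' where "A' = A \<union> step x ` S"
  \<comment> \<open>\<open>step x i\<close> may have been reached earlier through another edge; it
    then keeps its lift.\<close>
  define k' where "k' y = (if y \<in> A then k y else if y \<in> step x ` B then k x else Suc (k x))" for y
  from inv have origin: "origin \<in> A"
    and lift: "\<And>z. z \<in> A \<Longrightarrow> z \<in> lattice d \<and> reached (d + 1) bond_walk 0 \<rho> (z(d := k z))"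
    and dom: "\<And>z i. \<sigma> (z, step z i) \<noteq> None \<Longrightarrow> z \<in> A"
    and closed: "\<And>z i. \<sigma> (z, step z i) = Some True \<Longrightarrow> i < d \<Longrightarrow> step z i \<in> A"
    and col: "\<And>z i h w. z \<in> lattice d \<Longrightarrow> i < d \<Longrightarrow> \<sigma> (z, step z i) = None \<Longrightarrow> \<rho> (z(d := h), w) = None"
    unfolding bond_inv_def by blast+
  have x_lat: "x \<in> lattice d" using lift[OF x] by blast
  have step_lat: "step x i \<in> lattice d" if "i \<in> D" for i
    using that x_lat D by (auto intro: step_in_lattice)
  have x_None: "\<rho> (x(d := h), w) = None" for h w
  proof -
    obtain i where "i \<in> D" using \<open>D \<noteq> {}\<close> by blast
    thus ?thesis using col[OF x_lat, of i] D by blast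
  qed
  have T_x: "\<exists>h. fst e = x(d := h)" if "e \<in> T" for e
    using that unfolding T by (metis (no_types, lifting) fst_conv imageE insertE)
  have T_None: "\<rho> e = None" if "e \<in> T" for e
    using T_x[OF that] x_None by (metis prod.collapse)
  have g_notin_T: "?g i \<notin> T" if "i \<in> D" for i
  proof
    assume "?g i \<in> T"
    hence "(step x i)(d := k x) = x(d := Suc (k x)) \<or> x(d := k x) = x(d := Suc (k x))"
      by (auto simp: T)
    thus False using x_lat step_lat[OF that] by (auto simp: lift_eq_iff)
  qed
  have \<rho>'_ext: "\<rho>' z = Some True" if "\<rho> z = Some True" for z
  proof -
    have "z \<notin> T" using T_None[of z] that by auto
    thus ?thesis using that x_None unfolding \<rho>'_def by (auto simp: reveal_def)
  qed
  have x_reached: "reached (d + 1) bond_walk 0 \<rho>' (x(d := k x))"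
    using lift[OF x] \<rho>'_ext by (auto intro: reached_mono)
  have \<sigma>'_other: "\<sigma>' (z, w) = \<sigma> (z, w)" if "z \<noteq> x" for z w
    using that by (auto simp: \<sigma>'_def reveal_def)
  have "bond_inv d \<sigma>' \<rho>' A' k'"
    unfolding bond_inv_def
  proof (intro conjI allI impI ballI)
    show "origin \<in> A'" using origin by (simp add: A'_def)
  next
    fix z assume z: "z \<in> A'"
    show "z \<in> lattice d" using z lift step_lat B by (auto simp: A'_def)
    show "reached (d + 1) bond_walk 0 \<rho>' (z(d := k' z))"
    proof (cases "z \<in> A")
      case True
      thus ?thesis using lift[OF True] \<rho>'_ext by (auto simp: k'_def intro: reached_mono)
    next
      case False
      then obtain i where i: "i \<in> S" "z = step x i" using z by (auto simp: A'_def)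
      hence "i \<in> D" "i < d" using B D by auto
      show ?thesis
      proof (cases "i \<in> B")
        case True
        have "\<rho>' (?g i) = Some True"
          using True B g_notin_T[OF \<open>i \<in> D\<close>] unfolding \<rho>'_def by (auto simp: reveal_def)
        hence "reached (d + 1) bond_walk 0 \<rho>' ((step x i)(d := k x))"
          using bond_reached_step[OF x_reached, of i] \<open>i < d\<close> by (simp add: step_lift)
        thus ?thesis using True False i by (simp add: k'_def)
      next
        case i_notin: False
        hence "U = T" using i U by auto
        hence T_True: "\<rho>' e = Some True" if "e \<in> T" for e
          using that unfolding \<rho>'_def by (simp add: reveal_def)
        have up: "reached (d + 1) bond_walk 0 \<rho>' (x(d := Suc (k x)))"
          using bond_reached_step[OF x_reached, of d] T_True[of "(x(d := k x), x(d := Suc (k x)))"]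
          by (simp add: step_lift_up T)
        have "(x(d := Suc (k x)), (step x i)(d := Suc (k x))) \<in> T"
          using i_notin \<open>i \<in> D\<close> by (auto simp: T)
        hence "reached (d + 1) bond_walk 0 \<rho>' ((step x i)(d := Suc (k x)))"
          using bond_reached_step[OF up, of i] T_True \<open>i < d\<close> by (simp add: step_lift)
        moreover have "k' z = Suc (k x)" using False i_notin i by (auto simp: k'_def)
        ultimately show ?thesis using i by simp
      qed
    qed
  next
    fix z i assume "\<sigma>' (z, step z i) \<noteq> None"
    thus "z \<in> A'" using x dom \<sigma>'_other[of z] by (cases "z = x") (auto simp: A'_def)
  next
    fix z i assume z: "\<sigma>' (z, step z i) = Some True" "i < d"
    from z(1) show "step z i \<in> A'"
      unfolding \<sigma>'_def
    proof (rule reveal_cases_True)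
      assume "\<sigma> (z, step z i) = Some True"
      thus ?thesis using closed z(2) by (simp add: A'_def)
    qed (auto simp: A'_def)
  next
    fix z i h w assume z: "z \<in> lattice d" "i < d" "\<sigma>' (z, step z i) = None"
    have "z \<noteq> x" using z(2,3) D by (auto simp: \<sigma>'_def reveal_eq_None)
    have neq: "z(d := h) \<noteq> x(d := h')" for h' using \<open>z \<noteq> x\<close> z(1) x_lat by (simp add: lift_eq_iff)
    hence "(z(d := h), w) \<notin> T" using T_x[of "(z(d := h), w)"] by (metis fst_conv)
    moreover have "(z(d := h), w) \<notin> ?g ` D"
    proof
      assume "(z(d := h), w) \<in> ?g ` D"
      then obtain j where "(z(d := h), w) = ?g j" by (rule imageE)
      thus False using neq[of "k x"] by (metis prod.inject)
    qed
    moreover have "\<rho> (z(d := h), w) = None"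
      using col[OF z(1,2)] z(3) \<sigma>'_other[OF \<open>z \<noteq> x\<close>] by simp
    ultimately show "\<rho>' (z(d := h), w) = None"
      unfolding \<rho>'_def reveal_eq_None by simp
  qed
  thus ?thesis unfolding \<sigma>'_def \<rho>'_def by blast
qed

text \<open>Same scheme as \<open>site_domination_step\<close>, counting hidden edges; a path of
  \<open>N\<close> steps has \<open>N\<close> edges, hence no successor.\<close>

lemma bond_domination_step:
  assumes p: "0 \<le> p" "p \<le> 1" and \<epsilon>: "0 \<le> \<epsilon>" "\<epsilon> \<le> 1" "real d * \<epsilon> \<le> p ^ (d + 1)" and "0 < d"
    and inv: "bond_inv d \<sigma> \<rho> A k"
  shows "path_prob (oriented_edges d) (p + \<epsilon> * (1 - p)) (path_sets d bond_walk N) \<sigma> \<le>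
    path_prob (oriented_edges (d + 1)) p (path_sets (d + 1) bond_walk N) \<rho>"
  using inv
proof (induction "card {e \<in> (\<lambda>(x, i). (x, step x i)) ` ({x \<in> lattice d. level d x \<le> N} \<times> {..<d}). \<sigma> e = None}"
    arbitrary: \<sigma> \<rho> A k rule: less_induct)
  case less
  have origin: "origin \<in> A"
    and lift: "\<And>z. z \<in> A \<Longrightarrow> z \<in> lattice d \<and> reached (d + 1) bond_walk 0 \<rho> (z(d := k z))"
    and closed: "\<And>z i. \<sigma> (z, step z i) = Some True \<Longrightarrow> i < d \<Longrightarrow> step z i \<in> A"
    and col: "\<And>z i h w. z \<in> lattice d \<Longrightarrow> i < d \<Longrightarrow> \<sigma> (z, step z i) = None \<Longrightarrow> \<rho> (z(d := h), w) = None"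
    using less.prems unfolding bond_inv_def by blast+
  show ?case
  proof (cases "\<exists>x i. x \<in> A \<and> level d x < N \<and> i < d \<and> \<sigma> (x, step x i) = None")
    case True
    then obtain x i where x: "x \<in> A" and i: "level d x < N" "i < d" "\<sigma> (x, step x i) = None"
      by blast
    have x_lat: "x \<in> lattice d" using lift[OF x] by blast
    define D where "D = {i. i < d \<and> \<sigma> (x, step x i) = None}"
    have D: "finite D" "D \<subseteq> {..<d}" "i \<in> D" using i by (auto simp: D_def)
    have cardD: "card D \<le> d" using card_mono[OF _ D(2)] by simp
    have step_lat: "step x j \<in> lattice d" if "j \<in> D" for j
      using that x_lat D by (auto intro: step_in_lattice)
    let ?c = "\<lambda>i. (x, step x i)" and ?g = "\<lambda>i. (x(d := k x), (step x i)(d := k x))"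
    define T where "T B = insert (x(d := k x), x(d := Suc (k x)))
      ((\<lambda>i. (x(d := Suc (k x)), (step x i)(d := Suc (k x)))) ` (D - B))" for B
    have ineq: "path_prob (oriented_edges d) (p + \<epsilon> * (1 - p)) (path_sets d bond_walk N) (reveal ?c D S \<sigma>)
        \<le> path_prob (oriented_edges (d + 1)) p (path_sets (d + 1) bond_walk N)
          (reveal id (T B) U (reveal ?g D B \<rho>))"
      if BSU: "B \<subseteq> S" "S \<subseteq> D" "U \<subseteq> T B" "S = B \<or> U = T B" for B S U
    proof -
      have "D \<noteq> {}" using D by auto
      obtain A' k' where k': "bond_inv d (reveal ?c D S \<sigma>) (reveal id (T B) U (reveal ?g D B \<rho>)) A' k'"
        using bond_inv_step[OF less.prems x D_def \<open>D \<noteq> {}\<close> BSU(1,2) T_def BSU(3,4)] by blast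
      show ?thesis
      proof (rule less.hyps[OF _ k'], rule card_undetermined_less)
        show "finite ((\<lambda>(x, i). (x, step x i)) ` ({x \<in> lattice d. level d x \<le> N} \<times> {..<d}))"
          by (intro finite_imageI finite_cartesian_product finite_level_le) simp
        show "(x, step x i) \<in> (\<lambda>(x, i). (x, step x i)) ` ({x \<in> lattice d. level d x \<le> N} \<times> {..<d})"
          using i x_lat by force
        show "\<sigma> (x, step x i) = None" by fact
        show "reveal ?c D S \<sigma> (x, step x i) \<noteq> None"
          using D by (simp add: reveal_eq_None)
      qed (simp add: reveal_eq_None)
    qed
    have edge: "(x(d := h), (step x j)(d := h)) \<in> oriented_edges (d + 1)" if "j \<in> D" for h j
    proof -
      have "j < d + 1" "step (x(d := h)) j = (step x j)(d := h)" using that D by (auto simp: step_lift)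
      thus ?thesis using lift_in_lattice[OF x_lat] unfolding oriented_edges_step by (metis (mono_tags, lifting) mem_Collect_eq)
    qed
    have up_edge: "(x(d := h), x(d := Suc h)) \<in> oriented_edges (d + 1)" for h
    proof -
      have "d < d + 1" "step (x(d := h)) d = x(d := Suc h)" by (auto simp: step_lift_up)
      thus ?thesis using lift_in_lattice[OF x_lat] unfolding oriented_edges_step by (metis (mono_tags, lifting) mem_Collect_eq)
    qed
    show ?thesis
    proof (rule path_prob_reveal_step[where d = d and D = D and c = ?c and g = ?g and T = T])
      show "finitary (oriented_edges d) (path_sets d bond_walk N)"
        by (rule percolation_model.finitary_path_sets[OF bond_model]) fact
      show "finitary (oriented_edges (d + 1)) (path_sets (d + 1) bond_walk N)"
        by (rule percolation_model.finitary_path_sets[OF bond_model]) simp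
      show "inj_on ?c D" by (simp add: inj_on_def)
      show "?c ` D \<subseteq> oriented_edges d" using x_lat D unfolding oriented_edges_step by blast
      show "\<sigma> (?c j) = None" if "j \<in> D" for j using that by (simp add: D_def)
      show "inj_on ?g D"
        using step_lat by (auto simp: inj_on_def lift_eq_iff)
      show "?g ` D \<subseteq> oriented_edges (d + 1)" using edge by blast
      show "\<rho> (?g j) = None" if "j \<in> D" for j
        using col[OF x_lat i(2,3)] by simp
      show "finite (T B) \<and> T B \<subseteq> oriented_edges (d + 1) \<and> card (T B) \<le> d + 1 \<and> T B \<inter> ?g ` D = {}"
        if "B \<subseteq> D" for B
      proof (intro conjI)
        show "finite (T B)" using D by (simp add: T_def)
        show "T B \<subseteq> oriented_edges (d + 1)"
          using edge up_edge unfolding T_def by blast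
        have "card (T B) \<le> Suc (card ((\<lambda>i. (x(d := Suc (k x)), (step x i)(d := Suc (k x)))) ` (D - B)))"
          unfolding T_def by (rule card_insert_le_m1) auto
        also have "\<dots> \<le> Suc (card D)"
          using D by (meson Suc_le_mono card_image_le card_mono finite_Diff Diff_subset le_trans)
        finally show "card (T B) \<le> d + 1" using cardD by simp
        show "T B \<inter> ?g ` D = {}"
          using x_lat step_lat by (auto simp: T_def lift_eq_iff)
      qed
      show "\<rho> e = None" if "B \<subseteq> D" "e \<in> T B" for B e
        using that col[OF x_lat i(2,3)] unfolding T_def by auto
      show "path_prob (oriented_edges d) (p + \<epsilon> * (1 - p)) (path_sets d bond_walk N) (reveal ?c D B \<sigma>)
          \<le> path_prob (oriented_edges (d + 1)) p (path_sets (d + 1) bond_walk N)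
            (reveal id (T B) U (reveal ?g D B \<rho>))" if "B \<subseteq> D" "U \<subseteq> T B" for B U
        using ineq[of B B U] that by blast
      show "path_prob (oriented_edges d) (p + \<epsilon> * (1 - p)) (path_sets d bond_walk N) (reveal ?c D D \<sigma>)
          \<le> path_prob (oriented_edges (d + 1)) p (path_sets (d + 1) bond_walk N)
            (reveal id (T B) (T B) (reveal ?g D B \<rho>))" if "B \<subseteq> D" for B
        using ineq[of B D "T B"] that by blast
    qed (fact p \<epsilon> D(1) cardD)+
  next
    case False
    show ?thesis
    proof (cases "\<exists>\<omega>. hits (path_sets d bond_walk N) (override \<sigma> \<omega>)")
      case True
      then obtain \<omega> ds where ds: "\<And>m. ds m < d" "\<And>m. m < N \<Longrightarrow> override \<sigma> \<omega> (bond_walk ds m)"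
        unfolding hits_path_sets by auto
      have "walk ds m \<in> A" if "m \<le> N" for m
        using that
      proof (induction m)
        case (Suc m)
        have "level d (walk ds m) = m" using ds(1) by (simp add: level_walk)
        hence "\<sigma> (bond_walk ds m) \<noteq> None" using Suc False ds(1)[of m] by (auto simp: bond_walk_def)
        hence "\<sigma> (walk ds m, step (walk ds m) (ds m)) = Some True"
          using ds(2)[of m] Suc.prems by (auto simp: override_def bond_walk_def)
        thus ?case using closed ds(1) by simp
      qed (simp add: origin)
      hence "reached (d + 1) bond_walk 0 \<rho> ((walk ds N)(d := k (walk ds N)))"
        using lift by blast
      moreover have "level d (walk ds N) = N" using ds(1) by (simp add: level_walk)
      ultimately have "path_prob (oriented_edges (d + 1)) p (path_sets (d + 1) bond_walk N) \<rho> = 1"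
        by (intro path_prob_reached) (auto simp: level_lift)
      thus ?thesis by (simp add: path_prob_le_1)
    next
      case False
      thus ?thesis by (simp add: path_prob_eq_0 path_prob_nonneg)
    qed
  qed
qed

theorem bond_domination:
  assumes p: "0 \<le> p" "p \<le> 1" and \<epsilon>: "0 \<le> \<epsilon>" "\<epsilon> \<le> 1" "real d * \<epsilon> \<le> p ^ (d + 1)" and "0 < d"
  shows "bond_percolation_prob d (p + \<epsilon> * (1 - p)) \<le> bond_percolation_prob (d + 1) p"
proof -
  interpret M: percolation_model d "oriented_edges d" bond_walk by (rule bond_model) fact
  interpret N: percolation_model "d + 1" "oriented_edges (d + 1)" bond_walk by (rule bond_model) simp
  have "reached (d + 1) bond_walk 0 Map.empty (origin(d := 0))"
    unfolding reached_def
    by (rule exI[of _ "\<lambda>_. 0"], rule exI[of _ 0]) (simp add: origin_def fun_eq_iff)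
  hence inv: "bond_inv d Map.empty Map.empty {origin} (\<lambda>_. 0)"
    by (simp add: bond_inv_def)
  have "M.percolation_prob (p + \<epsilon> * (1 - p)) \<le> N.finite_path_prob p (Suc n)" for n
    using M.percolation_prob_le bond_domination_step[OF p \<epsilon> \<open>0 < d\<close> inv] by (rule order_trans)
  hence "M.percolation_prob (p + \<epsilon> * (1 - p)) \<le> N.percolation_prob p"
    by (rule N.percolation_prob_ge)
  thus ?thesis using \<open>0 < d\<close> by (simp add: bond_percolation_prob_eq)
qed

section \<open>Contours of finite planar clusters\<close>

text \<open>Counterclockwise quarter turn: with \<open>f\<close> as outward normal,
  \<open>rot f\<close> follows the side with the square on the left.\<close>

definition rot :: "int \<times> int \<Rightarrow> int \<times> int" where
  "rot f = (- snd f, fst f)"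

definition compass :: "(int \<times> int) set" where
  "compass = {(1, 0), (0, 1), (-1, 0), (0, -1)}"

definition boundary :: "(int \<times> int) set \<Rightarrow> ((int \<times> int) \<times> (int \<times> int)) set" where
  "boundary R = {(z, f). z \<in> R \<and> f \<in> compass \<and> z + f \<notin> R}"

text \<open>A pair \<open>(z, f)\<close> stands for the side in direction \<open>f\<close> of the unit square centred at \<open>z\<close>, traversed
  in direction \<open>rot f\<close>. The three moves are a left turn, a straight step and a right turn.\<close>

definition move :: "nat \<Rightarrow> (int \<times> int) \<times> (int \<times> int) \<Rightarrow> (int \<times> int) \<times> (int \<times> int)" where
  "move m b = (case b of (z, f) \<Rightarrow>
    if m = 0 then (z, rot f) else if m = 1 then (z + rot f, f) else (z + rot f + f, - rot f))"

text \<open>The two squares ahead of the side decide. If only two diagonally opposite squares at a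
  corner lie in \<open>R\<close>, the contour turns left and stays at \<open>z\<close>, which keeps
  them apart.\<close>

definition turn :: "(int \<times> int) set \<Rightarrow> (int \<times> int) \<times> (int \<times> int) \<Rightarrow> nat" where
  "turn R b = (case b of (z, f) \<Rightarrow>
    if z + rot f \<notin> R then 0 else if z + rot f + f \<notin> R then 1 else 2)"

text \<open>A contour is coded by its turns from a fixed start, the lower side of the square at the
  origin. Every cluster of the origin in the quadrant has this side on its boundary, so no starting
  point has to be counted.\<close>

primrec contour :: "(nat \<Rightarrow> nat) \<Rightarrow> nat \<Rightarrow> (int \<times> int) \<times> (int \<times> int)" where
  "contour ms 0 = ((0, 0), (0, -1))"
| "contour ms (Suc i) = move (ms i) (contour ms i)"

lemma contour_cong: "(\<And>j. j < i \<Longrightarrow> ms j = ms' j) \<Longrightarrow> contour ms i = contour ms' i"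
  by (induction i) auto

lemma rot_compass: "f \<in> compass \<Longrightarrow> rot f \<in> compass" "f \<in> compass \<Longrightarrow> - f \<in> compass"
  by (auto simp: compass_def rot_def)

lemma rot_rot [simp]: "rot (rot f) = - f" "rot (- f) = - rot f"
  by (auto simp: rot_def prod_eq_iff)

lemma finite_boundary: "finite R \<Longrightarrow> finite (boundary R)"
  by (rule finite_subset[of _ "R \<times> compass"]) (auto simp: boundary_def compass_def)

lemma move_boundary:
  assumes "b \<in> boundary R"
  shows "move (turn R b) b \<in> boundary R"
proof -
  obtain z f where b: "b = (z, f)" by (cases b)
  have "z + rot f + f + - rot f = z + f" "z + rot f + f = z + f + rot f" by simp_all
  thus ?thesis
    using assms unfolding b by (auto simp: move_def turn_def boundary_def rot_compass)
qed

text \<open>The side \<open>(w, g)\<close> determines the move by which it was entered, since the three cases differ in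
  whether \<open>w - rot g\<close> and \<open>w + g - rot g\<close> belong to \<open>R\<close>.\<close>

lemma move_inj: "inj_on (\<lambda>b. move (turn R b) b) (boundary R)"
proof -
  define enter where "enter c = (case c of (w, g) \<Rightarrow>
    if w - rot g \<notin> R then (w, - rot g) else if w + g - rot g \<notin> R then (w - rot g, g)
    else (w + g - rot g, rot g))" for c :: "(int \<times> int) \<times> (int \<times> int)"
  have "enter (move (turn R b) b) = b" if b_in: "b \<in> boundary R" for b
  proof -
    obtain z f where b: "b = (z, f)" by (cases b)
    have zf: "z \<in> R" "z + f \<notin> R" using b_in by (auto simp: b boundary_def)
    show ?thesis
    proof (cases "z + rot f \<in> R")
      case False
      thus ?thesis using zf by (simp add: b turn_def move_def enter_def)
    next
      case True
      thus ?thesis using zf by (simp add: b turn_def move_def enter_def algebra_simps)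
    qed
  qed
  thus ?thesis by (rule inj_on_inverseI)
qed

text \<open>Twice the position of the corner at which the side is entered.\<close>

definition corner :: "(int \<times> int) \<times> (int \<times> int) \<Rightarrow> int \<times> int" where
  "corner b = fst b + fst b + snd b - rot (snd b)"

text \<open>Each of the three moves enters the new side at the corner where the old one
  ends.\<close>

lemma corner_move: "corner (move m b) = corner b + rot (snd b) + rot (snd b)"
  by (cases b) (simp add: corner_def move_def algebra_simps zero_prod_def)

text \<open>The outward normal is a direction of the oriented lattice; only across such sides could
  an oriented path leave \<open>R\<close>.\<close>

definition positive :: "(int \<times> int) \<times> (int \<times> int) \<Rightarrow> bool" where
  "positive b \<longleftrightarrow> snd b = (1, 0) \<or> snd b = (0, 1)"

lemma corner_contour: "corner (contour ms n) = corner (contour ms 0) +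
    (\<Sum>i<n. rot (snd (contour ms i))) + (\<Sum>i<n. rot (snd (contour ms i)))"
  by (induction n) (simp_all add: corner_move algebra_simps del: contour.simps(1))

text \<open>Along a closed contour the directions \<open>rot f\<close>, hence also the normals
  \<open>f\<close>, sum to zero. The coordinates of a normal add up to 1 if it is positive and to -1
  otherwise, so both kinds are equally frequent.\<close>

lemma closed_contour_positive:
  assumes "contour ms n = contour ms 0" and "\<And>i. i < n \<Longrightarrow> snd (contour ms i) \<in> compass"
  shows "n = 2 * card {i. i < n \<and> positive (contour ms i)}"
proof -
  let ?f = "\<lambda>i. snd (contour ms i)"
  let ?P = "{i. i < n \<and> positive (contour ms i)}"
  have eq: "(\<Sum>i<n. rot (?f i)) + (\<Sum>i<n. rot (?f i)) = 0"
    using corner_contour[of ms n] assms(1) by (simp add: add.assoc del: contour.simps)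
  have "fst (\<Sum>i<n. rot (?f i)) = 0" "snd (\<Sum>i<n. rot (?f i)) = 0"
    using arg_cong[OF eq, of fst] arg_cong[OF eq, of snd] by auto
  hence "(\<Sum>i<n. snd (?f i)) = 0" "(\<Sum>i<n. fst (?f i)) = 0"
    by (simp_all add: fst_sum snd_sum rot_def sum_negf)
  hence "0 = (\<Sum>i<n. fst (?f i) + snd (?f i))" by (simp add: sum.distrib)
  also have "\<dots> = (\<Sum>i<n. if positive (contour ms i) then 1 else - 1)"
  proof (intro sum.cong refl)
    fix i assume "i \<in> {..<n}"
    thus "fst (?f i) + snd (?f i) = (if positive (contour ms i) then 1 else - 1)"
      using assms(2)[of i] by (auto simp: compass_def positive_def)
  qed
  also have "\<dots> = (\<Sum>i<n. 2 * (if positive (contour ms i) then 1 else 0) - 1)"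
    by (intro sum.cong) auto
  also have "\<dots> = 2 * int (card ?P) - int n"
    by (simp add: sum_subtractf sum_distrib_left[symmetric] sum.If_cases Collect_conj_eq lessThan_def)
  finally show ?thesis by linarith
qed

text \<open>Under an injective map a finite orbit returns to its start. \<open>n\<close> is the
  first return time, so the sides before it are distinct.\<close>

lemma contour_exists:
  assumes "finite R" "(0, 0) \<in> R" "(0, -1) \<notin> R"
  obtains n ms where "0 < n" "n \<le> card (boundary R)" "\<And>i. ms i < 3"
    "\<And>i. i < n \<Longrightarrow> contour ms i \<in> boundary R" "inj_on (contour ms) {..<n}"
    "n = 2 * card {i. i < n \<and> positive (contour ms i)}"
proof -
  let ?b = "((0, 0), (0, -1)) :: (int \<times> int) \<times> (int \<times> int)"
  \<comment> \<open>Extension by the identity off the boundary makes the map injective on the whole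
    type.\<close>
  define p where "p b = (if b \<in> boundary R then move (turn R b) b else b)" for b
  have b: "?b \<in> boundary R" using assms by (auto simp: boundary_def compass_def)
  have "inj p"
  proof (rule injI)
    fix b c assume "p b = p c"
    thus "b = c"
      using move_boundary[of b R] move_boundary[of c R] inj_onD[OF move_inj, of R b c]
      unfolding p_def by (metis (full_types))
  qed
  have in_bd: "(p ^^ i) ?b \<in> boundary R" for i
    using b move_boundary by (induction i) (auto simp: p_def)
  have "finite {c. \<exists>n. c = (p ^^ n) ?b}"
    using in_bd by (intro finite_subset[OF _ finite_boundary[OF assms(1)]]) auto
  hence ex: "\<exists>n>0. (p ^^ n) ?b = ?b"
    using funpow_inj_finite[OF \<open>inj p\<close>, of ?b] by metis
  define n where "n = (LEAST n. n > 0 \<and> (p ^^ n) ?b = ?b)"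
  have n: "n > 0" "(p ^^ n) ?b = ?b"
    using LeastI_ex[OF ex] unfolding n_def by auto
  have least: "(p ^^ m) ?b \<noteq> ?b" if "0 < m" "m < n" for m
    using not_less_Least[of m "\<lambda>n. n > 0 \<and> (p ^^ n) ?b = ?b"] that unfolding n_def by auto
  define ms where "ms i = turn R ((p ^^ i) ?b)" for i
  have tr: "contour ms i = (p ^^ i) ?b" for i
    using in_bd by (induction i) (auto simp: p_def ms_def)
  have inj: "inj_on (contour ms) {..<n}"
    using inj_on_funpow_least[OF n(2) least] unfolding tr[abs_def] lessThan_atLeast0 .
  show ?thesis
  proof (rule that[of n ms])
    show "0 < n" by fact
    show "ms i < 3" for i by (simp add: ms_def turn_def split: prod.split)
    show bd: "contour ms i \<in> boundary R" for i using tr in_bd by simp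
    show "inj_on (contour ms) {..<n}" by fact
    have "card (contour ms ` {..<n}) \<le> card (boundary R)"
      using bd by (intro card_mono finite_boundary assms(1)) auto
    thus "n \<le> card (boundary R)" using card_image[OF inj] by simp
    show "n = 2 * card {i. i < n \<and> positive (contour ms i)}"
    proof (rule closed_contour_positive)
      show "contour ms n = contour ms 0" using tr[of n] tr[of 0] n by simp
      show "snd (contour ms i) \<in> compass" for i using bd[of i] by (auto simp: boundary_def)
    qed
  qed
qed

section \<open>The Peierls bound\<close>

text \<open>\<open>nat\<close> truncates: (0, -1) is sent to the origin. Hence the sign conditions
  in \<open>vert_step\<close> and \<open>vert_inj\<close>.\<close>

definition vert :: "int \<times> int \<Rightarrow> nat \<Rightarrow> nat" where
  "vert z = (\<lambda>j. if j = 0 then nat (fst z) else if j = 1 then nat (snd z) else 0)"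

definition axis :: "int \<times> int \<Rightarrow> nat" where
  "axis f = (if f = (1, 0) then 0 else 1)"

lemma axis_less: "axis f < 2"
  by (simp add: axis_def)

lemma vert_in_lattice: "vert z \<in> lattice 2"
  by (auto simp: vert_def lattice_def)

lemma vert_step:
  assumes "0 \<le> fst z" "0 \<le> snd z" "positive (z, f)"
  shows "vert (z + f) = step (vert z) (axis f)"
proof
  fix j
  show "vert (z + f) j = step (vert z) (axis f) j"
    using assms by (cases "f = (1, 0)")
      (simp_all add: vert_def step_def unit_vector_def axis_def positive_def nat_add_distrib)
qed

lemma vert_inj:
  assumes "0 \<le> fst z" "0 \<le> snd z" "0 \<le> fst w" "0 \<le> snd w" "vert z = vert w"
  shows "z = w"
proof (rule prod_eqI)
  have "nat (fst z) = nat (fst w)" using fun_cong[OF assms(5), of 0] by (simp add: vert_def)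
  thus "fst z = fst w" using assms by simp
  have "nat (snd z) = nat (snd w)" using fun_cong[OF assms(5), of 1] by (simp add: vert_def)
  thus "snd z = snd w" using assms by simp
qed

lemma level_vert: "level 2 (vert z) = nat (fst z) + nat (snd z)"
  by (simp add: level_def vert_def numeral_2_eq_2)

lemma hits_reached:
  assumes "reached D \<kappa> a (\<lambda>c. Some (\<omega> c)) x" "N \<le> level D x + a"
  shows "hits (path_sets D \<kappa> N) \<omega>"
proof -
  obtain ds n where ds: "\<forall>m. ds m < D" "\<forall>m<n + a. Some (\<omega> (\<kappa> ds m)) = Some True" "walk ds n = x"
    using assms(1) unfolding reached_def by blast
  moreover have "level D x = n" using ds level_walk by blast
  ultimately show ?thesis unfolding hits_path_sets using assms(2) by (intro exI[of _ ds]) auto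
qed

lemma sum_eighth_powers: "(\<Sum>n=1..K. (1 / 8 :: real) ^ n) \<le> 1 / 7"
proof -
  have "7 * (\<Sum>n=1..K. (1 / 8 :: real) ^ n) = 1 - (1 / 8) ^ K"
  proof (induction K)
    case (Suc K)
    have "7 * (\<Sum>n=1..Suc K. (1 / 8 :: real) ^ n) = 7 * (\<Sum>n=1..K. (1 / 8) ^ n) + 7 * (1 / 8) ^ Suc K"
      by simp
    also have "\<dots> = 1 - (1 / 8) ^ Suc K" unfolding Suc.IH by simp
    finally show ?case .
  qed simp
  moreover have "0 \<le> (1 / 8 :: real) ^ K" by simp
  ultimately show ?thesis by linarith
qed

text \<open>\<open>e x i\<close> is the edge or vertex that has to be open to continue a path from \<open>x\<close> in direction \<open>i\<close>.\<close>

locale planar_model = percolation_model 2 I \<kappa> for I :: "'c set" and \<kappa> +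
  fixes e :: "(nat \<Rightarrow> nat) \<Rightarrow> nat \<Rightarrow> 'c" and a :: nat and Q0 :: "'c set"
  assumes e_in: "\<And>x i. x \<in> lattice 2 \<Longrightarrow> i < 2 \<Longrightarrow> e x i \<in> I"
    and e_inj: "\<And>x y i. e x i = e y i \<Longrightarrow> x = y"
    and reached_step: "\<And>\<rho> x i. reached 2 \<kappa> a \<rho> x \<Longrightarrow> i < 2 \<Longrightarrow> \<rho> (e x i) = Some True \<Longrightarrow>
      reached 2 \<kappa> a \<rho> (step x i)"
    and Q0: "finite Q0" "card Q0 \<le> 1" "Q0 \<subseteq> I"
    and reached_origin: "\<And>\<rho>. (\<And>c. c \<in> Q0 \<Longrightarrow> \<rho> c = Some True) \<Longrightarrow> reached 2 \<kappa> a \<rho> origin"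
begin

definition barrier :: "nat \<Rightarrow> (nat \<Rightarrow> nat) \<Rightarrow> 'c set" where
  "barrier n ms = (\<lambda>i. e (vert (fst (contour ms i))) (axis (snd (contour ms i)))) `
     {i. i < n \<and> positive (contour ms i)}"

text \<open>Restricted functions, so that at most 3^n codes are counted. An arbitrary code need not
  trace a boundary and may meet few edges or vertices; the size condition excludes it.\<close>

definition barriers :: "nat \<Rightarrow> (nat \<Rightarrow> nat) set" where
  "barriers n = {ms \<in> PiE {..<n} (\<lambda>_. {..<3}). n \<le> 4 * card (barrier n ms)}"

lemma barrier_in: "barrier n ms \<subseteq> I"
  unfolding barrier_def by (intro image_subsetI e_in vert_in_lattice axis_less)

lemma finite_barrier: "finite (barrier n ms)"
  by (simp add: barrier_def)

text \<open>A crude bound on the number of boundary sides, which leaves finitely many lengths in the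
  union bound.\<close>

definition contour_bound :: "nat \<Rightarrow> nat" where
  "contour_bound N = card (({0..int N} \<times> {0..int N}) \<times> compass)"

lemma blocked:
  assumes "\<not> hits (path_sets 2 \<kappa> N) \<omega>" "\<And>c. c \<in> Q0 \<Longrightarrow> \<omega> c"
  shows "\<exists>n\<in>{1..contour_bound N}. \<exists>ms\<in>barriers n. \<forall>c\<in>barrier n ms. \<not> \<omega> c"
proof -
  let ?\<rho> = "\<lambda>c. Some (\<omega> c)"
  \<comment> \<open>As \<open>?\<rho>\<close> is defined everywhere, \<open>reached\<close> is plain
    reachability. Without the sign conditions the truncation in \<open>vert\<close> would put (0,
    -1) into \<open>R\<close>.\<close>
  define R where "R = {z. 0 \<le> fst z \<and> 0 \<le> snd z \<and> reached 2 \<kappa> a ?\<rho> (vert z)}"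
  have R_sub: "R \<subseteq> {0..int N} \<times> {0..int N}"
  proof
    fix z assume z: "z \<in> R"
    have "level 2 (vert z) + a < N"
      using hits_reached[of 2 \<kappa> a \<omega> "vert z" N] z assms(1) unfolding R_def by force
    thus "z \<in> {0..int N} \<times> {0..int N}" using z by (auto simp: level_vert R_def mem_Times_iff)
  qed
  hence fin: "finite R" by (rule finite_subset) simp
  have "vert (0, 0) = origin" by (simp add: vert_def origin_def fun_eq_iff)
  hence in_R: "(0, 0) \<in> R" using reached_origin[of ?\<rho>] assms(2) by (simp add: R_def)
  have out: "(0, -1) \<notin> R" by (simp add: R_def)
  obtain n ms where n: "0 < n" "n \<le> card (boundary R)" and ms: "\<And>i. ms i < 3"
    and bd: "\<And>i. i < n \<Longrightarrow> contour ms i \<in> boundary R" and inj: "inj_on (contour ms) {..<n}"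
    and half: "n = 2 * card {i. i < n \<and> positive (contour ms i)}"
    by (rule contour_exists[OF fin in_R out]) blast
  let ?P = "{i. i < n \<and> positive (contour ms i)}"
  let ?e = "\<lambda>i. e (vert (fst (contour ms i))) (axis (snd (contour ms i)))"
  have nonneg: "0 \<le> fst (fst (contour ms i))" "0 \<le> snd (fst (contour ms i))"
    "reached 2 \<kappa> a ?\<rho> (vert (fst (contour ms i)))"
    "fst (contour ms i) + snd (contour ms i) \<notin> R" if "i < n" for i
    using bd[OF that] by (auto simp: boundary_def R_def)
  have closed: "\<not> \<omega> (?e i)" if i: "i \<in> ?P" for i
  proof
    assume open_e: "\<omega> (?e i)"
    obtain z f where zf: "contour ms i = (z, f)" by (cases "contour ms i")
    have z: "0 \<le> fst z" "0 \<le> snd z" "reached 2 \<kappa> a ?\<rho> (vert z)" "z + f \<notin> R" "positive (z, f)"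
      using nonneg[of i] i zf by auto
    have "reached 2 \<kappa> a ?\<rho> (vert (z + f))"
      unfolding vert_step[OF z(1,2,5)]
      using open_e zf by (intro reached_step[OF z(3)]) (auto simp: axis_def)
    moreover have "0 \<le> fst (z + f)" "0 \<le> snd (z + f)" using z by (auto simp: positive_def)
    ultimately show False using z(4) by (simp add: R_def)
  qed
  \<comment> \<open>A vertex can lie across two positive sides, one for each axis, but by
    \<open>e_inj\<close> not across more. So the barrier has at least half as many elements as there
    are positive sides, that is, a quarter of \<open>n\<close>.\<close>
  have "inj_on (\<lambda>i. (?e i, axis (snd (contour ms i)))) ?P"
  proof (rule inj_onI)
    fix i j assume ij: "i \<in> ?P" "j \<in> ?P"
      "(?e i, axis (snd (contour ms i))) = (?e j, axis (snd (contour ms j)))"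
    have "vert (fst (contour ms i)) = vert (fst (contour ms j))"
      using ij(3) e_inj by (metis prod.inject)
    hence "fst (contour ms i) = fst (contour ms j)"
      using nonneg[of i] nonneg[of j] ij by (intro vert_inj) auto
    moreover have "snd (contour ms i) = snd (contour ms j)"
      using ij by (auto simp: positive_def axis_def split: if_splits)
    ultimately have "contour ms i = contour ms j" by (simp add: prod_eq_iff)
    thus "i = j" using inj ij by (auto dest: inj_onD)
  qed
  hence "card ?P \<le> card (barrier n ms \<times> {0, 1::nat})"
    by (rule card_inj_on_le) (auto simp: barrier_def axis_def)
  hence "n \<le> 4 * card (barrier n ms)"
    using half by (simp add: card_cartesian_product)
  moreover have "barrier n (restrict ms {..<n}) = barrier n ms"
  proof -
    have "contour (restrict ms {..<n}) i = contour ms i" if "i < n" for i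
      using that by (intro contour_cong) auto
    thus ?thesis unfolding barrier_def by (intro image_cong) auto
  qed
  ultimately have "restrict ms {..<n} \<in> barriers n" "\<forall>c\<in>barrier n (restrict ms {..<n}). \<not> \<omega> c"
    using ms closed by (auto simp: barriers_def barrier_def)
  moreover have "card (boundary R) \<le> contour_bound N"
    unfolding contour_bound_def using R_sub
    by (intro card_mono) (auto simp: boundary_def compass_def)
  ultimately show ?thesis using n by (intro bexI[of _ n] bexI[of _ "restrict ms {..<n}"]) auto
qed

text \<open>A barrier for length n has at least n / 4 elements, so the closing probability (1/24)^4
  makes it closed with probability at most (1/24)^n. The 3^n codes leave (1/8)^n, which sums to at
  most 1/7; with (1/24)^4 for \<open>Q0\<close> the total stays below 1/2.\<close>

lemma finite_path_prob_ge: "1 / 2 \<le> finite_path_prob (1 - (1 / 24) ^ 4) N"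
proof -
  let ?p = "1 - (1 / 24) ^ 4 :: real"
  let ?M = "bernoulli_percolation I ?p"
  interpret prob_space ?M by (rule prob_space_bernoulli_percolation)
  let ?K = "contour_bound N"
  define closed where "closed Q = {\<omega> \<in> space ?M. \<forall>c\<in>Q. \<omega> c = False}" for Q
  have p: "0 \<le> ?p" "?p \<le> 1" by (simp_all add: power_one_over)
  have closed_meas: "closed Q \<in> events" if "Q \<subseteq> I" "finite Q" for Q
    unfolding closed_def using measurable_coordinate[of _ I ?p] that
    by (simp add: subset_iff)
  have closed_prob: "prob (closed Q) = ((1 / 24) ^ 4) ^ card Q" if "Q \<subseteq> I" "finite Q" for Q
    unfolding closed_def using prob_all_equal[OF that p, of False] by simp
  have fin: "finite (barriers n)" for n
    by (rule finite_subset[of _ "PiE {..<n} (\<lambda>_. {..<3})"]) (auto simp: barriers_def intro: finite_PiE)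
  have card: "card (barriers n) \<le> 3 ^ n" for n
  proof -
    have "card (barriers n) \<le> card (PiE {..<n} (\<lambda>_. {..<3::nat}))"
      unfolding barriers_def by (intro card_mono finite_PiE) auto
    thus ?thesis by (simp add: card_PiE)
  qed
  have n_bound: "prob (\<Union>ms\<in>barriers n. closed (barrier n ms)) \<le> (1 / 8) ^ n" for n
  proof -
    have "prob (closed (barrier n ms)) \<le> (1 / 24) ^ n" if "ms \<in> barriers n" for ms
    proof -
      have "prob (closed (barrier n ms)) = (1 / 24) ^ (4 * card (barrier n ms))"
        using closed_prob[OF barrier_in finite_barrier] by (simp add: power_mult)
      also have "\<dots> \<le> (1 / 24) ^ n"
        using that by (intro power_decreasing) (auto simp: barriers_def)
      finally show ?thesis .
    qed
    note single = this
    have "prob (\<Union>ms\<in>barriers n. closed (barrier n ms)) \<le> (\<Sum>ms\<in>barriers n. prob (closed (barrier n ms)))"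
      using closed_meas[OF barrier_in finite_barrier]
      by (intro finite_measure_subadditive_finite fin) blast
    also have "\<dots> \<le> real (card (barriers n)) * (1 / 24) ^ n"
      by (rule sum_bounded_above) (rule single)
    also have "\<dots> \<le> 3 ^ n * (1 / 24) ^ n"
      using of_nat_mono[OF card[of n], where 'a = real] by (intro mult_right_mono) simp_all
    also have "\<dots> = (1 / 8 :: real) ^ n" by (simp flip: power_mult_distrib)
    finally show ?thesis .
  qed
  have UN_meas: "(\<Union>ms\<in>barriers n. closed (barrier n ms)) \<in> events" for n
    using fin closed_meas[OF barrier_in finite_barrier] by (intro sets.finite_UN) auto
  have Q0_meas: "closed {c} \<in> events" if "c \<in> Q0" for c
    using that Q0 by (intro closed_meas) auto
  let ?A = "{\<omega> \<in> space ?M. hits (path_sets 2 \<kappa> N) \<omega>}"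
  let ?B = "\<Union>c\<in>Q0. closed {c}"
  let ?C = "\<Union>n\<in>{1..?K}. \<Union>ms\<in>barriers n. closed (barrier n ms)"
  have B: "?B \<in> events" using Q0_meas Q0 by (intro sets.finite_UN) auto
  have C: "?C \<in> events" by (rule sets.finite_UN) (simp, rule UN_meas)
  have "prob ?B \<le> (\<Sum>c\<in>Q0. prob (closed {c}))"
    using Q0_meas Q0 by (intro finite_measure_subadditive_finite) auto
  also have "\<dots> = (\<Sum>c\<in>Q0. (1 / 24) ^ 4)"
    using Q0 by (intro sum.cong refl) (simp add: closed_prob subset_iff)
  also have "\<dots> \<le> 1 * (1 / 24) ^ 4" using Q0(2) by simp
  finally have PB: "prob ?B \<le> (1 / 24) ^ 4" by simp
  have "prob ?C \<le> (\<Sum>n=1..?K. prob (\<Union>ms\<in>barriers n. closed (barrier n ms)))"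
    using UN_meas by (intro finite_measure_subadditive_finite) auto
  also have "\<dots> \<le> (\<Sum>n=1..?K. (1 / 8) ^ n)" by (intro sum_mono n_bound)
  also have "\<dots> \<le> 1 / 7" by (rule sum_eighth_powers)
  finally have PC: "prob ?C \<le> 1 / 7" .
  have "space ?M - ?A \<subseteq> ?B \<union> ?C"
  proof
    fix \<omega> assume \<omega>: "\<omega> \<in> space ?M - ?A"
    show "\<omega> \<in> ?B \<union> ?C"
    proof (cases "\<forall>c\<in>Q0. \<omega> c")
      case True
      hence "\<exists>n\<in>{1..?K}. \<exists>ms\<in>barriers n. \<forall>c\<in>barrier n ms. \<not> \<omega> c"
        using \<omega> by (intro blocked) auto
      thus ?thesis using \<omega> by (auto simp: closed_def)
    qed (use \<omega> in \<open>auto simp: closed_def\<close>)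
  qed
  hence "prob (space ?M - ?A) \<le> prob (?B \<union> ?C)"
    using B C by (intro finite_measure_mono) auto
  also have "\<dots> \<le> prob ?B + prob ?C" using B C by (rule measure_Un_le)
  also have "\<dots> \<le> 1 / 2" using PB PC by (simp add: power_one_over)
  finally have "1 / 2 \<le> prob ?A"
    using prob_compl[OF sets_hits[of ?p N]] by simp
  thus ?thesis by (simp add: path_prob_def)
qed

lemma percolation_prob_pos: "0 < percolation_prob (1 - (1 / 24) ^ 4)"
  using percolation_prob_ge[of "1 / 2", OF finite_path_prob_ge] by simp

end

text \<open>A site path needs its starting vertex open, hence \<open>Q0\<close> is the origin. Sites
  are also why \<open>e_inj\<close> fixes the direction: one vertex can be entered along both
  axes.\<close>

lemma site_planar_model: "planar_model (lattice 2) walk step 1 {origin}"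
proof -
  interpret percolation_model 2 "lattice 2" walk by (rule site_model) simp
  show ?thesis
  proof
    show "x = y" if "step x i = step y i" for x y i
    proof
      fix j show "x j = y j" using fun_cong[OF that, of j] by (simp add: step_def)
    qed
    show "reached 2 walk 1 \<rho> origin" if "\<And>c. c \<in> {origin} \<Longrightarrow> \<rho> c = Some True" for \<rho>
      unfolding reached_def by (rule exI[of _ "\<lambda>_. 0"], rule exI[of _ 0]) (simp add: that)
    show "reached 2 walk 1 \<rho> (step x i)"
      if "reached 2 walk 1 \<rho> x" "i < 2" "\<rho> (step x i) = Some True" for \<rho> x i
      by (rule site_reached_step[OF that])
  qed (auto intro: step_in_lattice)
qed

lemma bond_planar_model:
  "planar_model (oriented_edges 2) bond_walk (\<lambda>x i. (x, step x i)) 0 {}"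
proof -
  interpret percolation_model 2 "oriented_edges 2" bond_walk by (rule bond_model) simp
  show ?thesis
  proof
    show "reached 2 bond_walk 0 \<rho> origin" for \<rho>
      unfolding reached_def by (rule exI[of _ "\<lambda>_. 0"], rule exI[of _ 0]) simp
  qed (auto simp: oriented_edges_step intro: bond_reached_step)
qed

section \<open>Strict inequality\<close>

text \<open>Let c be the right-hand infimum. A sprinkling leads from some \<open>p\<close> below c
  to a point \<open>p0\<close> at or just above c where \<open>\<theta>\<close> is positive. Since c
  > 0, the allowed \<epsilon> does not vanish near c; since c < 1, the gap stays small relative to
  \<open>1 - p\<close>.\<close>

lemma critical_point_less:
  fixes \<theta> \<theta>' :: "real \<Rightarrow> real"
  assumes d: "0 < d"
    and dom: "\<And>p \<epsilon>. 0 < p \<Longrightarrow> p \<le> 1 \<Longrightarrow> 0 \<le> \<epsilon> \<Longrightarrow> \<epsilon> \<le> 1 \<Longrightarrow> real d * \<epsilon> \<le> p ^ (d + 1) \<Longrightarrow>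
      0 < \<theta> (p + \<epsilon> * (1 - p)) \<Longrightarrow> 0 < \<theta>' p"
    and zero: "\<And>p. 0 \<le> p \<Longrightarrow> p \<le> 1 \<Longrightarrow> real d * p < 1 \<Longrightarrow> \<theta> p = 0"
    and nontrivial: "0 < q" "q < 1" "0 < \<theta> q"
  shows "Inf {p \<in> {0..1}. \<theta>' p > 0} < Inf {p \<in> {0..1}. \<theta> p > 0}"
proof -
  let ?S = "{p \<in> {0..1}. \<theta> p > 0}" and ?S' = "{p \<in> {0..1}. \<theta>' p > 0}"
  define c where "c = Inf ?S"
  have q: "q \<in> ?S" using nontrivial by simp
  have bdd: "bdd_below ?S" "bdd_below ?S'" by (auto intro: bdd_belowI[of _ 0])
  have "1 / real d \<le> c"
    unfolding c_def
  proof (rule cInf_greatest)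
    show "?S \<noteq> {}" using q by blast
    fix p assume p: "p \<in> ?S"
    hence "\<not> real d * p < 1" using zero[of p] by auto
    thus "1 / real d \<le> p" using d by (simp add: field_simps)
  qed
  moreover have "0 < 1 / real d" using d by simp
  ultimately have c_pos: "0 < c" by linarith
  have c_less: "c < 1" using cInf_lower[OF q bdd(1)] nontrivial unfolding c_def by simp
  \<comment> \<open>Since \<open>p0 - p < 2 * \<delta>\<close> and \<open>1 - c \<le> 1 - p\<close>
    will hold, this value gives \<open>real d * \<epsilon> \<le> (c / 2) ^ (d + 1)\<close>; the
    other bound on \<open>\<eta>\<close> keeps \<open>p\<close> above \<open>c / 2\<close>.\<close>
  define \<delta> where "\<delta> = (1 - c) * (c / 2) ^ (d + 1) / (2 * real d)"
  define \<eta> where "\<eta> = min (c / 2) \<delta>"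
  have "0 < \<delta>" unfolding \<delta>_def using c_pos c_less d by simp
  hence \<eta>: "0 < \<eta>" "\<eta> \<le> c / 2" "\<eta> \<le> \<delta>" unfolding \<eta>_def using c_pos by auto
  define p where "p = c - \<eta>"
  have p: "0 < p" "p < c" "c / 2 \<le> p" "p \<le> 1" using \<eta> c_pos c_less unfolding p_def by auto
  obtain p0 where p0: "p0 \<in> ?S" "p0 < c + \<eta>"
    using cInf_lessD[of ?S "c + \<eta>"] q \<eta> unfolding c_def by auto
  have "c \<le> p0" using cInf_lower[OF p0(1) bdd(1)] unfolding c_def .
  define \<epsilon> where "\<epsilon> = (p0 - p) / (1 - p)"
  have "p + \<epsilon> * (1 - p) = p0" unfolding \<epsilon>_def using p c_less by simp
  moreover have "0 \<le> \<epsilon>" "\<epsilon> \<le> 1" unfolding \<epsilon>_def using p \<open>c \<le> p0\<close> p0 c_less by auto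
  moreover have "real d * \<epsilon> \<le> p ^ (d + 1)"
  proof -
    have "\<epsilon> \<le> (2 * \<delta>) / (1 - c)"
      unfolding \<epsilon>_def using p \<open>c \<le> p0\<close> p0(2) \<eta> c_less unfolding p_def by (intro frac_le) auto
    hence "real d * \<epsilon> \<le> real d * ((2 * \<delta>) / (1 - c))" by (intro mult_left_mono) auto
    also have "\<dots> = (c / 2) ^ (d + 1)" unfolding \<delta>_def using d c_less by simp
    also have "\<dots> \<le> p ^ (d + 1)" using p c_pos by (intro power_mono) auto
    finally show ?thesis .
  qed
  ultimately have "0 < \<theta>' p" using dom[of p \<epsilon>] p p0 by simp
  hence "p \<in> ?S'" using p by simp
  hence "Inf ?S' \<le> p" using bdd(2) by (rule cInf_lower)
  thus ?thesis using p unfolding c_def by linarith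
qed

lemma site_percolation_prob_Suc_pos:
  assumes "0 < p" "p \<le> 1" "0 \<le> \<epsilon>" "\<epsilon> \<le> 1" "real d * \<epsilon> \<le> p ^ (d + 1)" "0 < d"
    and "0 < site_percolation_prob d (p + \<epsilon> * (1 - p))"
  shows "0 < site_percolation_prob (d + 1) p"
  using site_domination[OF assms(1-6)] mult_pos_pos[OF assms(1,7)] by linarith

lemma bond_percolation_prob_Suc_pos:
  assumes "0 < p" "p \<le> 1" "0 \<le> \<epsilon>" "\<epsilon> \<le> 1" "real d * \<epsilon> \<le> p ^ (d + 1)" "0 < d"
    and "0 < bond_percolation_prob d (p + \<epsilon> * (1 - p))"
  shows "0 < bond_percolation_prob (d + 1) p"
  using bond_domination[OF _ assms(2-6)] assms(1,7) by linarith

text \<open>The Peierls bound settles d = 2; domination with \<open>\<epsilon>\<close> equal to 0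
  carries positivity to d + 1 at the same parameter.\<close>

lemma site_percolation_prob_nontrivial:
  assumes "2 \<le> d"
  shows "0 < site_percolation_prob d (1 - (1 / 24) ^ 4)"
  using assms
proof (induction d rule: dec_induct)
  case base
  show ?case using planar_model.percolation_prob_pos[OF site_planar_model]
    by (simp add: site_percolation_prob_eq)
next
  case (step d)
  thus ?case
    using site_percolation_prob_Suc_pos[of "1 - (1 / 24) ^ 4" 0 d] by (simp add: power_one_over)
qed

lemma bond_percolation_prob_nontrivial:
  assumes "2 \<le> d"
  shows "0 < bond_percolation_prob d (1 - (1 / 24) ^ 4)"
  using assms
proof (induction d rule: dec_induct)
  case base
  show ?case using planar_model.percolation_prob_pos[OF bond_planar_model]
    by (simp add: bond_percolation_prob_eq)
next
  case (step d)
  thus ?case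
    using bond_percolation_prob_Suc_pos[of "1 - (1 / 24) ^ 4" 0 d] by (simp add: power_one_over)
qed

theorem corollary3:
  shows "(\<forall>d\<ge>2. pc_bond (d + 1) < pc_bond d) \<and> (\<forall>d\<ge>2. pc_site (d + 1) < pc_site d)"
proof (intro conjI allI impI)
  fix d :: nat assume d: "2 \<le> d"
  hence "0 < d" by simp
  have q: "0 < 1 - (1 / 24 :: real) ^ 4" "1 - (1 / 24 :: real) ^ 4 < 1"
    by (simp_all add: power_one_over)
  show "pc_bond (d + 1) < pc_bond d"
    unfolding pc_bond_def
  proof (rule critical_point_less[where d = d and \<theta> = "bond_percolation_prob d", OF \<open>0 < d\<close> _ _ q bond_percolation_prob_nontrivial[OF d]])
    show "0 < bond_percolation_prob (d + 1) p"
      if "0 < p" "p \<le> 1" "0 \<le> \<epsilon>" "\<epsilon> \<le> 1" "real d * \<epsilon> \<le> p ^ (d + 1)"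
        "0 < bond_percolation_prob d (p + \<epsilon> * (1 - p))" for p \<epsilon>
      using that \<open>0 < d\<close> by (intro bond_percolation_prob_Suc_pos)
    show "bond_percolation_prob d p = 0" if "0 \<le> p" "p \<le> 1" "real d * p < 1" for p
      using percolation_model.percolation_prob_eq_0[OF bond_model[OF \<open>0 < d\<close>] that]
        bond_percolation_prob_eq[OF \<open>0 < d\<close>] by simp
  qed
  show "pc_site (d + 1) < pc_site d"
    unfolding pc_site_def
  proof (rule critical_point_less[where d = d and \<theta> = "site_percolation_prob d", OF \<open>0 < d\<close> _ _ q site_percolation_prob_nontrivial[OF d]])
    show "0 < site_percolation_prob (d + 1) p"
      if "0 < p" "p \<le> 1" "0 \<le> \<epsilon>" "\<epsilon> \<le> 1" "real d * \<epsilon> \<le> p ^ (d + 1)"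
        "0 < site_percolation_prob d (p + \<epsilon> * (1 - p))" for p \<epsilon>
      using that \<open>0 < d\<close> by (intro site_percolation_prob_Suc_pos)
    show "site_percolation_prob d p = 0" if "0 \<le> p" "p \<le> 1" "real d * p < 1" for p
      using percolation_model.percolation_prob_eq_0[OF site_model[OF \<open>0 < d\<close>] that]
        site_percolation_prob_eq[OF \<open>0 < d\<close>] by simp
  qed
qed

end
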